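(* Let $\operatorname{char}\mathbb{F}=3$, let $\mathcal{O}$ be the split Okubo algebra over $\mathbb{F}$, and let $e$ be its quaternionic idempotent. Consider an element $x\in Z(\mathcal{O})$ such that $x*x=0$. Then there are two cases possible: (1) $x\perp C_{\mathcal{O}}(e)$, $e+x$ is a singular idempotent, and for any $y\in O_{\mathcal{O}}(x)$ we have $y*y=0$; (2) $x\not\perp C_{\mathcal{O}}(e)$, $e+x$ is a quadratic idempotent, and all elements $y\in O_{\mathcal{O}}(x)$ such that $y*y=0$ are contained in a single two-dimensional subspace. All elements $x$ of the first type belong to the same orbit under the action of the automorphism group of $\mathcal{O}$. If $\mathbb{F}$ is algebraically closed, then all elements $x$ of the second type also belong to the same orbit.
   Context: The split Okubo algebra over a field $\mathbb{F}$ is the $8$-dimensional $\mathbb{F}$-algebra $\mathcal{O}=\mathcal{O}_{1,1}$ with basis $z_{1,0},z_{2,0},z_{0,1},z_{0,2},z_{1,1},z_{2,2},z_{1,2},z_{2,1}$ and (bilinear, non-associative) multiplication $*$ given by the table (the entry in row $a$, column $b$ is $a*b$): $$\begin{array}{c|cccccccc} * & z_{1,0} & z_{2,0} & z_{0,1} & z_{0,2} & z_{1,1} & z_{2,2} & z_{1,2} & z_{2,1}\\ \hline z_{1,0} & z_{2,0} & 0 & -z_{1,1} & 0 & -z_{2,1} & 0 & 0 & -z_{0,1}\\ z_{2,0} & 0 & z_{1,0} & 0 & -z_{2,2} & 0 & -z_{1,2} & -z_{0,2} & 0\\ z_{0,1} & 0 & -z_{2,1} & z_{0,2} & 0 & 0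 & -z_{2,0} & 0 & -z_{2,2}\\ z_{0,2} & -z_{1,2} & 0 & 0 & z_{0,1} & -z_{1,0} & 0 & -z_{1,1} & 0\\ z_{1,1} & 0 & -z_{0,1} & -z_{1,2} & 0 & z_{2,2} & 0 & -z_{2,0} & 0\\ z_{2,2} & -z_{0,2} & 0 & 0 & -z_{2,1} & 0 & z_{1,1} & 0 & -z_{1,0}\\ z_{1,2} & -z_{2,2} & 0 & -z_{1,0} & 0 & 0 & -z_{0,1} & z_{2,1} & 0\\ z_{2,1} & 0 & -z_{1,1} & 0 & -z_{2,0} & -z_{0,2} & 0 & 0 & z_{1,2}\end{array}$$ Its norm is the quadratic form $n$ with $n(z_{i,j})=0$ for all basis elements and polar form $n(a,b)=n(a+b)-n(a)-n(b)$ given on the basis by $n(z_{1,0},z_{2,0})=n(z_{0,1},z_{0,2})=n(z_{1,1},z_{2,2})=n(z_{1,2},z_{2,1})=1$, and $0$ on all other pairs of basis elements. $Z(\mathcal{O})$ is the set of zero divisors, i.e. nonzero $a$ such that $a*b=0$ or $b*a=0$ for some nonzero $b$. The orthogonalizer of $a$ is $O_{\mathcal{O}}(a)=\{b\in\mathcal{O}\mid a*b=b*a=0\}$, and its centralizer is $C_{\mathcal{O}}(a)=\{b\in\mathcal{O}\mid a*b=b*a\}$. For $Y\subset\mathcal{O}$, $x\perp Y$ means $n(x,y)=0$ for all $y\in Y$. A para-quaternion (resp. para-quadratic) algebra is an algebra obtained from a quaternion algebra (resp. a two-dimensional Hurwitz algebra, i.e. a quadratic étale algebra) by replacing its product with $(x,y)\mapsto\overline{x}\,\overline{y}$,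 where the bar is the standard conjugation. In characteristic $3$, a nonzero idempotent $f=f*f$ of $\mathcal{O}$ is called quaternionic if its centralizer contains a para-quaternion algebra; quadratic if its centralizer contains a para-quadratic algebra and no para-quaternion subalgebra; singular otherwise. It is known that the split Okubo algebra in characteristic $3$ has a unique quaternionic idempotent, namely $e=z_{1,0}+z_{2,0}+z_{0,1}+z_{0,2}+z_{1,1}+z_{2,2}+z_{1,2}+z_{2,1}$. *)

theory Defs
  imports "HOL-Analysis.Analysis" "HOL-Computational_Algebra.Polynomial"
begin

section \<open>Hurwitz and para-Hurwitz algebras\<close>

definition polar :: "('v::ab_group_add \<Rightarrow> 'a::ab_group_add) \<Rightarrow> 'v \<Rightarrow> 'v \<Rightarrow> 'a" where
  "polar N x y = N (x + y) - N x - N y"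

text \<open>The polar form is symmetric, so linearity in its first argument suffices.\<close>

definition quadratic_form_on :: "('a::field ^ 'n) set \<Rightarrow> ('a ^ 'n \<Rightarrow> 'a) \<Rightarrow> bool" where
  "quadratic_form_on V N \<longleftrightarrow>
     (\<forall>c. \<forall>x\<in>V. N (c *s x) = c\<^sup>2 * N x) \<and>
     (\<forall>x\<in>V. \<forall>y\<in>V. \<forall>z\<in>V. polar N (x + y) z = polar N x z + polar N y z) \<and>
     (\<forall>c. \<forall>x\<in>V. \<forall>z\<in>V. polar N (c *s x) z = c * polar N x z)"

definition nondegenerate_on :: "('a::field ^ 'n) set \<Rightarrow> ('a ^ 'n \<Rightarrow> 'a) \<Rightarrow> bool" where
  "nondegenerate_on V N \<longleftrightarrow> (\<forall>x\<in>V. (\<forall>y\<in>V. polar N x y = 0) \<longrightarrow> x = 0)"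

definition algebra_product_on ::
    "('a::field ^ 'n) set \<Rightarrow> ('a ^ 'n \<Rightarrow> 'a ^ 'n \<Rightarrow> 'a ^ 'n) \<Rightarrow> bool" where
  "algebra_product_on V m \<longleftrightarrow>
     (\<forall>x\<in>V. \<forall>y\<in>V. m x y \<in> V) \<and>
     (\<forall>x\<in>V. \<forall>y\<in>V. \<forall>z\<in>V. m (x + y) z = m x z + m y z \<and> m z (x + y) = m z x + m z y) \<and>
     (\<forall>c. \<forall>x\<in>V. \<forall>y\<in>V. m (c *s x) y = c *s m x y \<and> m x (c *s y) = c *s m x y)"

text \<open>
  A Hurwitz algebra is a unital algebra with a nondegenerate multiplicative quadratic form
  (its norm).  The finite-dimensional underlying space is a subspace \<open>V\<close> of a coordinate
  space; the product \<open>m\<close> need not be related to any product on the ambient space.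
  The Hurwitz algebras of dimension 4 are the quaternion algebras, those of dimension 2 the
  quadratic etale algebras.
\<close>

definition hurwitz_algebra_on ::
    "('a::field ^ 'n) set \<Rightarrow> ('a ^ 'n \<Rightarrow> 'a ^ 'n \<Rightarrow> 'a ^ 'n) \<Rightarrow> 'a ^ 'n \<Rightarrow> ('a ^ 'n \<Rightarrow> 'a) \<Rightarrow> bool" where
  "hurwitz_algebra_on V m u N \<longleftrightarrow>
     vec.subspace V \<and> algebra_product_on V m \<and>
     u \<in> V \<and> (\<forall>x\<in>V. m u x = x \<and> m x u = x) \<and>
     quadratic_form_on V N \<and> nondegenerate_on V N \<and>
     (\<forall>x\<in>V. \<forall>y\<in>V. N (m x y) = N x * N y)"

definition hurwitz_conj :: "'a::field ^ 'n \<Rightarrow> ('a ^ 'n \<Rightarrow> 'a) \<Rightarrow> 'a ^ 'n \<Rightarrow> 'a ^ 'n" where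
  "hurwitz_conj u N x = polar N x u *s u - x"

text \<open>
  \<open>para_hurwitz_on d V p\<close>: the product \<open>p\<close> on \<open>V\<close> is obtained from the product \<open>m\<close> of some
  \<open>d\<close>-dimensional Hurwitz algebra with the same underlying space.
\<close>

definition para_hurwitz_on ::
    "nat \<Rightarrow> ('a::field ^ 'n) set \<Rightarrow> ('a ^ 'n \<Rightarrow> 'a ^ 'n \<Rightarrow> 'a ^ 'n) \<Rightarrow> bool" where
  "para_hurwitz_on d V p \<longleftrightarrow>
     (\<exists>m u N. hurwitz_algebra_on V m u N \<and> vec.dim V = d \<and>
        (\<forall>x\<in>V. \<forall>y\<in>V. p x y = m (hurwitz_conj u N x) (hurwitz_conj u N y)))"

abbreviation para_quaternion_on ::
    "('a::field ^ 'n) set \<Rightarrow> ('a ^ 'n \<Rightarrow> 'a ^ 'n \<Rightarrow> 'a ^ 'n) \<Rightarrow> bool" where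
  "para_quaternion_on \<equiv> para_hurwitz_on 4"

abbreviation para_quadratic_on ::
    "('a::field ^ 'n) set \<Rightarrow> ('a ^ 'n \<Rightarrow> 'a ^ 'n \<Rightarrow> 'a ^ 'n) \<Rightarrow> bool" where
  "para_quadratic_on \<equiv> para_hurwitz_on 2"


section \<open>The split Okubo algebra\<close>

text \<open>The constructor \<open>Zij\<close> is the index of the basis element $z_{i,j}$.\<close>

datatype okubo_index = Z10 | Z20 | Z01 | Z02 | Z11 | Z22 | Z12 | Z21

lemma UNIV_okubo_index: "UNIV = {Z10, Z20, Z01, Z02, Z11, Z22, Z12, Z21}"
  by (auto intro: okubo_index.exhaust)

instance okubo_index :: finite
  by standard (simp add: UNIV_okubo_index)

type_synonym 'a okubo = "'a ^ okubo_index"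

abbreviation okubo_basis :: "okubo_index \<Rightarrow> 'a::field okubo" where
  "okubo_basis i \<equiv> axis i 1"

fun okubo_table :: "okubo_index \<Rightarrow> okubo_index \<Rightarrow> 'a::field okubo" where
  "okubo_table Z10 Z10 = okubo_basis Z20"
| "okubo_table Z10 Z01 = - okubo_basis Z11"
| "okubo_table Z10 Z11 = - okubo_basis Z21"
| "okubo_table Z10 Z21 = - okubo_basis Z01"
| "okubo_table Z20 Z20 = okubo_basis Z10"
| "okubo_table Z20 Z02 = - okubo_basis Z22"
| "okubo_table Z20 Z22 = - okubo_basis Z12"
| "okubo_table Z20 Z12 = - okubo_basis Z02"
| "okubo_table Z01 Z20 = - okubo_basis Z21"
| "okubo_table Z01 Z01 = okubo_basis Z02"
| "okubo_table Z01 Z22 = - okubo_basis Z20"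
| "okubo_table Z01 Z21 = - okubo_basis Z22"
| "okubo_table Z02 Z10 = - okubo_basis Z12"
| "okubo_table Z02 Z02 = okubo_basis Z01"
| "okubo_table Z02 Z11 = - okubo_basis Z10"
| "okubo_table Z02 Z12 = - okubo_basis Z11"
| "okubo_table Z11 Z20 = - okubo_basis Z01"
| "okubo_table Z11 Z01 = - okubo_basis Z12"
| "okubo_table Z11 Z11 = okubo_basis Z22"
| "okubo_table Z11 Z12 = - okubo_basis Z20"
| "okubo_table Z22 Z10 = - okubo_basis Z02"
| "okubo_table Z22 Z02 = - okubo_basis Z21"
| "okubo_table Z22 Z22 = okubo_basis Z11"
| "okubo_table Z22 Z21 = - okubo_basis Z10"
| "okubo_table Z12 Z10 = - okubo_basis Z22"
| "okubo_table Z12 Z01 = - okubo_basis Z10"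
| "okubo_table Z12 Z22 = - okubo_basis Z01"
| "okubo_table Z12 Z12 = okubo_basis Z21"
| "okubo_table Z21 Z20 = - okubo_basis Z11"
| "okubo_table Z21 Z02 = - okubo_basis Z20"
| "okubo_table Z21 Z11 = - okubo_basis Z02"
| "okubo_table Z21 Z21 = okubo_basis Z12"
| "okubo_table _ _ = 0"

definition okubo_mult :: "'a::field okubo \<Rightarrow> 'a okubo \<Rightarrow> 'a okubo"  (infixl "\<star>" 70) where
  "a \<star> b = (\<Sum>i\<in>UNIV. \<Sum>j\<in>UNIV. (a $ i * b $ j) *s okubo_table i j)"

text \<open>The unique quadratic form vanishing on the basis with the prescribed polar form.\<close>

definition okubo_norm :: "'a::field okubo \<Rightarrow> 'a" where
  "okubo_norm a = a $ Z10 * a $ Z20 + a $ Z01 * a $ Z02 + a $ Z11 * a $ Z22 + a $ Z12 * a $ Z21"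

definition zero_divisors :: "'a::field okubo set" where
  "zero_divisors = {a. a \<noteq> 0 \<and> (\<exists>b. b \<noteq> 0 \<and> (a \<star> b = 0 \<or> b \<star> a = 0))}"

definition orthogonalizer :: "'a::field okubo \<Rightarrow> 'a okubo set" where
  "orthogonalizer a = {b. a \<star> b = 0 \<and> b \<star> a = 0}"

definition centralizer :: "'a::field okubo \<Rightarrow> 'a okubo set" where
  "centralizer a = {b. a \<star> b = b \<star> a}"

definition perp :: "'a::field okubo \<Rightarrow> 'a okubo set \<Rightarrow> bool"  (infix "\<bottom>\<bottom>" 50) where
  "x \<bottom>\<bottom> Y \<longleftrightarrow> (\<forall>y\<in>Y. polar okubo_norm x y = 0)"

definition okubo_automorphism :: "('a::field okubo \<Rightarrow> 'a okubo) \<Rightarrow> bool" where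
  "okubo_automorphism f \<longleftrightarrow>
     Vector_Spaces.linear (*s) (*s) f \<and> bij f \<and> (\<forall>a b. f (a \<star> b) = f a \<star> f b)"

definition same_orbit :: "'a::field okubo \<Rightarrow> 'a okubo \<Rightarrow> bool" where
  "same_orbit x y \<longleftrightarrow> (\<exists>f. okubo_automorphism f \<and> f x = y)"


section \<open>Types of idempotents in characteristic 3\<close>

definition okubo_idempotent :: "'a::field okubo \<Rightarrow> bool" where
  "okubo_idempotent f \<longleftrightarrow> f \<noteq> 0 \<and> f \<star> f = f"

text \<open>
  A set \<open>V\<close> with \<open>para_hurwitz_on d V (\<star>)\<close> is automatically a subspace closed under \<open>\<star>\<close>,
  i.e. a subalgebra.
\<close>

definition contains_para_quaternion :: "'a::field okubo set \<Rightarrow> bool" where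
  "contains_para_quaternion S \<longleftrightarrow> (\<exists>V \<subseteq> S. para_quaternion_on V (\<star>))"

definition contains_para_quadratic :: "'a::field okubo set \<Rightarrow> bool" where
  "contains_para_quadratic S \<longleftrightarrow> (\<exists>V \<subseteq> S. para_quadratic_on V (\<star>))"

definition quaternionic_idempotent :: "'a::field okubo \<Rightarrow> bool" where
  "quaternionic_idempotent f \<longleftrightarrow>
     okubo_idempotent f \<and> contains_para_quaternion (centralizer f)"

definition quadratic_idempotent :: "'a::field okubo \<Rightarrow> bool" where
  "quadratic_idempotent f \<longleftrightarrow>
     okubo_idempotent f \<and> contains_para_quadratic (centralizer f) \<and>
     \<not> contains_para_quaternion (centralizer f)"

definition singular_idempotent :: "'a::field okubo \<Rightarrow> bool" where
  "singular_idempotent f \<longleftrightarrow>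
     okubo_idempotent f \<and> \<not> quaternionic_idempotent f \<and> \<not> quadratic_idempotent f"


section \<open>The two types of square-zero elements\<close>

definition first_type :: "'a::field okubo \<Rightarrow> 'a okubo \<Rightarrow> bool" where
  "first_type e x \<longleftrightarrow>
     x \<bottom>\<bottom> centralizer e \<and> singular_idempotent (e + x) \<and>
     (\<forall>y\<in>orthogonalizer x. y \<star> y = 0)"

definition second_type :: "'a::field okubo \<Rightarrow> 'a okubo \<Rightarrow> bool" where
  "second_type e x \<longleftrightarrow>
     \<not> x \<bottom>\<bottom> centralizer e \<and> quadratic_idempotent (e + x) \<and>
     (\<exists>W. vec.subspace W \<and> vec.dim W = 2 \<and> {y \<in> orthogonalizer x. y \<star> y = 0} \<subseteq> W)"

end

theory Submission
  imports Defs
begin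

text \<open>
  In characteristic 3, substitute \<open>x = 1 + u\<close>, \<open>y = 1 + v\<close> in the group algebra of \<open>(\<int>/3)\<^sup>2\<close>: it becomes
  the truncated polynomial algebra \<open>A = F[u,v]/(u\<^sup>3,v\<^sup>3)\<close>, and \<open>z\<^sub>i\<^sub>j \<mapsto> x\<^sup>i y\<^sup>j\<close> embeds the Okubo algebra into
  \<open>A\<close> with product \<open>f * g = f g + {f,g} - tr(f g)\<close>, where \<open>{x,y} = x y\<close> and \<open>tr\<close> is the coefficient
  of \<open>x\<^sup>0 y\<^sup>0\<close>.  After a further change of coordinates \<open>{f,g} = (1 - \<omega>)(f\<^sub>u g\<^sub>v - f\<^sub>v g\<^sub>u)\<close> with
  \<open>\<omega> = u\<^sup>2 v\<^sup>2\<close>, and \<open>tr f = f\<^sub>0 + f\<^sub>\<omega>\<close>.  Now \<open>f * f = 0\<close> means that \<open>f\<close> has order at least 2 and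
  that its quadratic part is a multiple of the square of a linear form; the idempotents are \<open>e + f\<close>
  with \<open>e = \<omega> - 1\<close> and \<open>f * f = 0\<close>; and the centralizer of \<open>f\<close> consists of the elements \<open>g\<close> with
  \<open>{f,g} = 0\<close>.  The first type is the vanishing of the quadratic part.  For the unit \<open>w\<close> of a
  para-Hurwitz algebra in the centralizer of \<open>e + f\<close>, imaginary elements \<open>g\<close> satisfy
  \<open>g * g = - N(g) w\<close>, while for \<open>f \<noteq> 0\<close> the elements \<open>g\<close> of order at least 2 commuting with \<open>e + f\<close>
  have square zero and the linear parts of the others lie on a line; this bounds the dimension of such
  an algebra and shows that \<open>e\<close> is the only quaternionic idempotent.  The orbits are computed
  with substitutions preserving the volume form \<open>(1 + \<omega>) du dv\<close>.
\<close>

section \<open>Hurwitz algebras and quadratic forms\<close>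

lemma polar_commute: "polar N x y = polar N y x"
  by (simp add: polar_def algebra_simps)

text \<open>A vector \<open>v\<close> outside the kernel spans a complement to it, so one linear
  condition lowers the dimension by at most one. Linearity is demanded on \<open>V\<close> alone,
  because a Hurwitz norm is controlled only there.\<close>

lemma kernel_on_subspace:
  fixes V :: "('a::field ^ 'n) set"
  assumes V: "vec.subspace V"
    and add: "\<And>x y. x \<in> V \<Longrightarrow> y \<in> V \<Longrightarrow> \<phi> (x + y) = \<phi> x + \<phi> y"
    and scale: "\<And>c x. x \<in> V \<Longrightarrow> \<phi> (c *s x) = c * \<phi> x"
  shows "vec.subspace {x \<in> V. \<phi> x = 0}" (is "vec.subspace ?K")
    and "vec.dim V \<le> Suc (vec.dim {x \<in> V. \<phi> x = (0::'a)})"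
proof -
  have "\<phi> 0 = 0" using scale[of 0 0] vec.subspace_0[OF V] by simp
  then show "vec.subspace ?K"
    using V add scale
    by (auto simp: vec.subspace_def)
  show "vec.dim V \<le> Suc (vec.dim ?K)"
  proof (cases "\<exists>v\<in>V. \<phi> v \<noteq> 0")
    case False
    then have "?K = V" by auto
    then show ?thesis by simp
  next
    case True
    then obtain v where v: "v \<in> V" "\<phi> v \<noteq> 0" by blast
    have "V \<subseteq> vec.span (insert v ?K)"
    proof
      fix x assume x: "x \<in> V"
      let ?c = "- (\<phi> x / \<phi> v)"
      have "?c *s v \<in> V" using V v(1) by (rule vec.subspace_scale)
      moreover have "\<phi> (?c *s v) = - \<phi> x" using v by (simp only: scale) simp
      ultimately have "x + ?c *s v \<in> ?K" using x V by (simp only: mem_Collect_eq add vec.subspace_add) simp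
      then have "x + ?c *s v \<in> vec.span (insert v ?K)" by (intro vec.span_base insertI2)
      moreover have "?c *s v \<in> vec.span (insert v ?K)" by (intro vec.span_scale vec.span_base insertI1)
      ultimately have "x + ?c *s v - ?c *s v \<in> vec.span (insert v ?K)" by (rule vec.span_diff)
      then show "x \<in> vec.span (insert v ?K)" by simp
    qed
    then have "vec.dim V \<le> vec.dim (insert v ?K)"
      by (metis vec.dim_span vec.dim_subset)
    also have "\<dots> \<le> Suc (vec.dim ?K)" by (simp add: vec.dim_insert)
    finally show ?thesis .
  qed
qed

text \<open>
  In a para-Hurwitz algebra the unit \<open>u\<close> of the Hurwitz product is an idempotent, and the
  imaginary elements \<open>x\<close> satisfy \<open>x\<^sup>2 = - N x u\<close> because conjugation acts on them as \<open>-1\<close>.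
\<close>

lemma para_hurwitz_onE:
  fixes V :: "('a::field ^ 'n) set"
  assumes "para_hurwitz_on d V p" "0 < d"
  obtains u N where "vec.subspace V" "vec.dim V = d" "u \<in> V" "u \<noteq> 0" "p u u = u"
    "quadratic_form_on V N" "nondegenerate_on V N" "N u = 1"
    "\<And>x. x \<in> V \<Longrightarrow> polar N x u = 0 \<Longrightarrow> p u x = - x"
    "\<And>x. x \<in> V \<Longrightarrow> polar N x u = 0 \<Longrightarrow> p x u = - x"
    "\<And>x. x \<in> V \<Longrightarrow> polar N x u = 0 \<Longrightarrow> p x x = - N x *s u"
proof -
  obtain m u N where H: "hurwitz_algebra_on V m u N" and dim: "vec.dim V = d"
    and p: "\<And>x y. x \<in> V \<Longrightarrow> y \<in> V \<Longrightarrow> p x y = m (hurwitz_conj u N x) (hurwitz_conj u N y)"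
    using assms(1) unfolding para_hurwitz_on_def by blast
  have V: "vec.subspace V" and u: "u \<in> V"
    and unit: "\<And>x. x \<in> V \<Longrightarrow> m u x = x" "\<And>x. x \<in> V \<Longrightarrow> m x u = x"
    and Q: "quadratic_form_on V N" and nd: "nondegenerate_on V N"
    and mult: "\<And>x y. x \<in> V \<Longrightarrow> y \<in> V \<Longrightarrow> N (m x y) = N x * N y"
    and clo: "\<And>x y. x \<in> V \<Longrightarrow> y \<in> V \<Longrightarrow> m x y \<in> V"
    and addl: "\<And>x y z. x \<in> V \<Longrightarrow> y \<in> V \<Longrightarrow> z \<in> V \<Longrightarrow> m (x + y) z = m x z + m y z"
    and addr: "\<And>x y z. x \<in> V \<Longrightarrow> y \<in> V \<Longrightarrow> z \<in> V \<Longrightarrow> m z (x + y) = m z x + m z y"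
    and scl: "\<And>c x y. x \<in> V \<Longrightarrow> y \<in> V \<Longrightarrow> m (c *s x) y = c *s m x y"
    and scr: "\<And>c x y. x \<in> V \<Longrightarrow> y \<in> V \<Longrightarrow> m x (c *s y) = c *s m x y"
    using H unfolding hurwitz_algebra_on_def algebra_product_on_def by blast+
  have plusV: "\<And>x y. x \<in> V \<Longrightarrow> y \<in> V \<Longrightarrow> x + y \<in> V" and scaleV: "\<And>c x. x \<in> V \<Longrightarrow> c *s x \<in> V"
    using V by (auto simp: vec.subspace_add vec.subspace_scale)
  have padd: "\<And>x y z. x \<in> V \<Longrightarrow> y \<in> V \<Longrightarrow> z \<in> V \<Longrightarrow> polar N (x + y) z = polar N x z + polar N y z"
    and psc: "\<And>c x z. x \<in> V \<Longrightarrow> z \<in> V \<Longrightarrow> polar N (c *s x) z = c * polar N x z"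
    and Nsc: "\<And>c x. x \<in> V \<Longrightarrow> N (c *s x) = c\<^sup>2 * N x"
    using Q unfolding quadratic_form_on_def by blast+
  have padd2: "\<And>x y z. x \<in> V \<Longrightarrow> y \<in> V \<Longrightarrow> z \<in> V \<Longrightarrow> polar N z (x + y) = polar N z x + polar N z y"
    by (metis padd polar_commute)
  have "u \<noteq> 0"
  proof
    assume "u = 0"
    then have "x = 0" if "x \<in> V" for x using unit(1)[OF that] scl[OF u that, of 0] by simp
    then have "V \<subseteq> {0}" by blast
    then have "vec.dim V = 0" by simp
    with dim assms(2) show False by simp
  qed
  \<comment> \<open>Multiplicativity gives \<open>N u * N u = N u\<close>; if \<open>N u\<close>
    were 0, the norm would vanish on \<open>V\<close> and its polar form with it.\<close>
  have "N u = 1"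
  proof (rule ccontr)
    assume "N u \<noteq> 1"
    then have "N u = 0" using mult[OF u u] unit(1)[OF u] by simp
    then have "N x = 0" if "x \<in> V" for x using mult[OF u that] unit(1)[OF that] by simp
    then have "polar N u y = 0" if "y \<in> V" for y using that u plusV by (simp add: polar_def)
    with nd u \<open>u \<noteq> 0\<close> show False unfolding nondegenerate_on_def by blast
  qed
  have "polar N u u = 2"
  proof -
    have "u + u = 2 *s u" by (simp add: vec_eq_iff)
    then show ?thesis unfolding polar_def using Nsc[OF u, of 2] \<open>N u = 1\<close> by simp
  qed
  then have conj_u: "hurwitz_conj u N u = u"
    by (simp add: hurwitz_conj_def vec_eq_iff)
  have conj_x: "hurwitz_conj u N x = (-1) *s x" if "polar N x u = 0" for x
    using that by (simp add: hurwitz_conj_def vec_eq_iff)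
  have polar_right: "polar N (m a b) (m c b) = polar N a c * N b" if "a \<in> V" "b \<in> V" "c \<in> V" for a b c
    using that unfolding polar_def
    by (simp add: mult plusV addl[symmetric] algebra_simps)
  have polar_left: "polar N (m b a) (m b c) = N b * polar N a c" if "a \<in> V" "b \<in> V" "c \<in> V" for a b c
    using that unfolding polar_def
    by (simp add: mult plusV addr[symmetric] algebra_simps)
  \<comment> \<open>This linearizes \<open>polar_right\<close> in its second factor: the cross terms
    at \<open>b + d\<close>.\<close>
  have polar_4: "polar N (m a b) (m c d) + polar N (m a d) (m c b) = polar N a c * polar N b d"
    if "a \<in> V" "b \<in> V" "c \<in> V" "d \<in> V" for a b c d
  proof -
    have "polar N (m a (b + d)) (m c (b + d)) = polar N a c * N (b + d)"
      using that by (intro polar_right) (auto intro: plusV)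
    moreover have "polar N (m a (b + d)) (m c (b + d))
        = polar N (m a b) (m c b) + polar N (m a b) (m c d)
          + (polar N (m a d) (m c b) + polar N (m a d) (m c d))"
      using that by (simp add: addr clo plusV padd padd2)
    moreover have "N (b + d) = N b + N d + polar N b d" by (simp add: polar_def)
    ultimately show ?thesis
      using that polar_right[of a b c] polar_right[of a d c] by (simp add: algebra_simps)
  qed
  have square: "m x x = - N x *s u" if x: "x \<in> V" "polar N x u = 0" for x
  proof -
    \<comment> \<open>By nondegeneracy it suffices to test against every \<open>y\<close>.
      \<open>polar_4\<close> with factors \<open>x\<close>, \<open>x\<close>, \<open>u\<close>,
      \<open>y\<close> has right-hand side 0 because \<open>x\<close> is orthogonal to
      \<open>u\<close>.\<close>
    have "polar N (m x x + N x *s u) y = 0" if y: "y \<in> V" for y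
    proof -
      have "polar N (m x x) y + polar N (m x y) x = 0"
        using polar_4[OF x(1) x(1) u y] x unit y by simp
      moreover have "polar N (m x y) x = N x * polar N u y"
        using polar_left[OF y x(1) u] unit(2)[OF x(1)] by (simp add: polar_commute)
      ultimately show ?thesis
        using x y u by (simp add: padd psc clo scaleV)
    qed
    moreover have "m x x + N x *s u \<in> V" using x u by (simp add: clo scaleV plusV)
    ultimately have "m x x + N x *s u = 0" using nd unfolding nondegenerate_on_def by blast
    then show ?thesis by (simp add: eq_neg_iff_add_eq_0)
  qed
  show thesis
  proof (rule that[OF V dim u \<open>u \<noteq> 0\<close> _ Q nd \<open>N u = 1\<close>])
    show "p u u = u" using p[OF u u] unit(1)[OF u] conj_u by simp
    fix x assume x: "x \<in> V" "polar N x u = 0"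
    show "p u x = - x"
      unfolding p[OF u x(1)] conj_u conj_x[OF x(2)] scr[OF u x(1)] unit(1)[OF x(1)] by simp
    show "p x u = - x"
      unfolding p[OF x(1) u] conj_u conj_x[OF x(2)] scl[OF x(1) u] unit(2)[OF x(1)] by simp
    have "p x x = (-1) *s ((-1) *s m x x)"
      unfolding p[OF x(1) x(1)] conj_x[OF x(2)]
      using x(1) by (simp only: scl scr scaleV)
    then show "p x x = - N x *s u" by (simp add: square[OF x])
  qed
qed

text \<open>
  If the norm vanishes on the hyperplane \<open>\<phi> = 0\<close> of the imaginary elements, then an imaginary
  \<open>y\<close> outside that hyperplane detects all of its vectors.
\<close>

lemma isotropic_imaginary_eq_0:
  fixes V :: "('a::field ^ 'n) set"
  assumes V: "vec.subspace V" "u \<in> V" and Q: "quadratic_form_on V N" "nondegenerate_on V N"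
    and u: "N u = 1" and two: "(2::'a) \<noteq> 0"
    and iso: "\<And>x. x \<in> V \<Longrightarrow> polar N x u = 0 \<Longrightarrow> P x \<Longrightarrow> N x = 0"
    and P_add: "\<And>x y. x \<in> V \<Longrightarrow> y \<in> V \<Longrightarrow> P x \<Longrightarrow> P y \<Longrightarrow> P (x + y)"
    and y: "y \<in> V" "polar N y u = 0" "\<And>x. x \<in> V \<Longrightarrow> polar N x u = 0 \<Longrightarrow> \<exists>k. P (x + k *s y)"
    and z: "z \<in> V" "polar N z u = 0" "P z" "polar N z y = 0"
  shows "z = 0"
proof -
  have plusV: "\<And>x y. x \<in> V \<Longrightarrow> y \<in> V \<Longrightarrow> x + y \<in> V" and scaleV: "\<And>c x. x \<in> V \<Longrightarrow> c *s x \<in> V"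
    using V by (auto simp: vec.subspace_add vec.subspace_scale)
  have padd: "\<And>x y z. x \<in> V \<Longrightarrow> y \<in> V \<Longrightarrow> z \<in> V \<Longrightarrow> polar N (x + y) z = polar N x z + polar N y z"
    and psc: "\<And>c x z. x \<in> V \<Longrightarrow> z \<in> V \<Longrightarrow> polar N (c *s x) z = c * polar N x z"
    and Nsc: "\<And>c x. x \<in> V \<Longrightarrow> N (c *s x) = c\<^sup>2 * N x"
    using Q unfolding quadratic_form_on_def by blast+
  have "u + u = 2 *s u" by (simp add: vec_eq_iff)
  then have uu: "polar N u u = 2" unfolding polar_def using Nsc[OF V(2), of 2] u by simp
  have "polar N v z = 0" if v: "v \<in> V" for v
  proof -
    \<comment> \<open>This correction makes \<open>v\<close> imaginary, and a multiple of
      \<open>y\<close> then brings it into \<open>P\<close>. Neither changes the pairing with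
      \<open>z\<close>, which is orthogonal to \<open>u\<close> and \<open>y\<close>.\<close>
    let ?c = "- (polar N v u / 2)"
    let ?w = "v + ?c *s u"
    have cu: "?c *s u \<in> V" using V(2) by (rule scaleV)
    then have w: "?w \<in> V" using v by (intro plusV)
    have w0: "polar N ?w u = 0"
      unfolding padd[OF v cu V(2)] psc[OF V(2) V(2)] uu using two by simp
    obtain k where k: "P (?w + k *s y)" using y(3)[OF w w0] by blast
    have ky: "k *s y \<in> V" using y(1) by (rule scaleV)
    let ?t = "?w + k *s y"
    have t: "?t \<in> V" "polar N ?t u = 0"
      using w ky w0 y V(2) by (simp_all only: plusV padd psc mult_zero_right add_0_right)
    have "N ?t = 0" using iso t k by blast
    moreover have "N z = 0" using iso z by blast
    moreover have "N (?t + z) = 0"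
    proof (rule iso)
      show "?t + z \<in> V" "P (?t + z)" using t z k by (auto intro: plusV P_add)
      show "polar N (?t + z) u = 0" using t z V(2) by (simp only: padd add_0_right)
    qed
    ultimately have "polar N ?t z = 0" by (simp add: polar_def)
    moreover have "polar N ?t z = polar N ?w z + k * polar N y z"
      unfolding padd[OF w ky z(1)] psc[OF y(1) z(1)] ..
    moreover have "polar N ?w z = polar N v z + ?c * polar N u z"
      unfolding padd[OF v cu z(1)] psc[OF V(2) z(1)] ..
    ultimately show ?thesis using z(2,4) by (simp add: polar_commute)
  qed
  then have "\<forall>v\<in>V. polar N z v = 0" by (simp add: polar_commute)
  with Q(2) z(1) show "z = 0" unfolding nondegenerate_on_def by blast
qed

text \<open>With a trivial predicate and \<open>y = 0\<close>, the preceding argument kills every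
  imaginary vector, and these form the kernel of one linear form.\<close>

lemma dim_le_1_if_isotropic_imaginary:
  fixes V :: "('a::field ^ 'n) set"
  assumes V: "vec.subspace V" "u \<in> V" and Q: "quadratic_form_on V N" "nondegenerate_on V N"
    and u: "N u = 1" and two: "(2::'a) \<noteq> 0"
    and iso: "\<And>x. x \<in> V \<Longrightarrow> polar N x u = 0 \<Longrightarrow> N x = 0"
  shows "vec.dim V \<le> 1"
proof -
  have lin: "\<And>x y. x \<in> V \<Longrightarrow> y \<in> V \<Longrightarrow> polar N (x + y) u = polar N x u + polar N y u"
    "\<And>c x. x \<in> V \<Longrightarrow> polar N (c *s x) u = c * polar N x u"
    using Q(1) V(2) unfolding quadratic_form_on_def by blast+
  have z: "0 \<in> V" "polar N 0 x = 0" if "x \<in> V" for x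
  proof -
    show "0 \<in> V" using V(1) by (rule vec.subspace_0)
    then have "polar N (0 *s 0) x = 0 * polar N 0 x"
      using Q(1) that unfolding quadratic_form_on_def by blast
    then show "polar N 0 x = 0" by simp
  qed
  have "{x \<in> V. polar N x u = 0} \<subseteq> {0}"
  proof clarify
    fix x assume x: "x \<in> V" "polar N x u = 0"
    show "x = 0"
      by (rule isotropic_imaginary_eq_0[OF V Q u two, of "\<lambda>_. True" 0])
        (use x z V(2) iso in \<open>auto simp: polar_commute[of N x 0]\<close>)
  qed
  then have "vec.dim {x \<in> V. polar N x u = 0} = 0" by simp
  then show ?thesis using kernel_on_subspace(2)[OF V(1) lin] by linarith
qed

text \<open>Being imaginary, lying in \<open>\<phi> = 0\<close> and being orthogonal to an imaginary
  \<open>y\<close> with \<open>\<phi> y \<noteq> 0\<close> are three linear conditions with only 0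
  in common. Without such a \<open>y\<close> all imaginary vectors are isotropic.\<close>

lemma dim_le_3_if_isotropic_imaginary_hyperplane:
  fixes V :: "('a::field ^ 'n) set"
  assumes V: "vec.subspace V" "u \<in> V" and Q: "quadratic_form_on V N" "nondegenerate_on V N"
    and u: "N u = 1" and two: "(2::'a) \<noteq> 0"
    and iso: "\<And>x. x \<in> V \<Longrightarrow> polar N x u = 0 \<Longrightarrow> \<phi> x = 0 \<Longrightarrow> N x = 0"
    and add: "\<And>x y. \<phi> (x + y) = \<phi> x + \<phi> y" and scale: "\<And>c x. \<phi> (c *s x) = c * (\<phi> x :: 'a)"
  shows "vec.dim V \<le> 3"
proof (cases "\<exists>y\<in>V. polar N y u = 0 \<and> \<phi> y \<noteq> 0")
  case False
  then have "vec.dim V \<le> 1"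
    using iso by (intro dim_le_1_if_isotropic_imaginary[OF V Q u two]) blast
  then show ?thesis by simp
next
  case True
  then obtain y where y: "y \<in> V" "polar N y u = 0" "\<phi> y \<noteq> 0" by blast
  have lin: "\<And>x y. x \<in> V \<Longrightarrow> y \<in> V \<Longrightarrow> polar N (x + y) w = polar N x w + polar N y w"
    "\<And>c x. x \<in> V \<Longrightarrow> polar N (c *s x) w = c * polar N x w" if "w \<in> V" for w
    using Q(1) that unfolding quadratic_form_on_def by blast+
  let ?A = "{x \<in> V. polar N x u = 0}"
  let ?B = "{x \<in> ?A. \<phi> x = 0}"
  let ?C = "{x \<in> ?B. polar N x y = 0}"
  note A = kernel_on_subspace[OF V(1) lin[OF V(2)]]
  note B = kernel_on_subspace[OF A(1) add scale]
  note C = kernel_on_subspace[OF B(1), of "\<lambda>x. polar N x y"]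
  have "?C \<subseteq> {0}"
  proof clarify
    fix x assume x: "x \<in> V" "polar N x u = 0" "\<phi> x = 0" "polar N x y = 0"
    show "x = 0"
    proof (rule isotropic_imaginary_eq_0[OF V Q u two, of "\<lambda>x. \<phi> x = 0" y])
      show "\<exists>k. \<phi> (v + k *s y) = 0" for v
        using y(3) by (intro exI[of _ "- (\<phi> v / \<phi> y)"]) (simp only: add scale, simp)
    qed (use x y iso add in auto)
  qed
  then have "vec.dim ?C = 0" by simp
  moreover have "vec.dim ?B \<le> Suc (vec.dim ?C)" by (rule C(2)) (use lin[OF y(1)] in auto)
  ultimately show ?thesis using A(2) B(2) by linarith
qed

section \<open>Planes spanned by two vectors, and para-quadratic algebras on them\<close>

lemma dim_span_pair:
  fixes p q :: "'a::field ^ 'n"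
  assumes indep: "\<And>s t. s *s p + t *s q = 0 \<Longrightarrow> s = 0 \<and> t = 0"
  shows "vec.dim (vec.span {p, q}) = 2"
proof -
  have "p \<notin> vec.span {q}"
  proof
    assume "p \<in> vec.span {q}"
    then obtain t where "p = t *s q" by (auto simp: vec.span_singleton)
    then show False using indep[of 1 "- t"] by simp
  qed
  moreover have "q \<noteq> 0" using indep[of 0 1] by auto
  ultimately show ?thesis by (simp add: vec.dim_insert)
qed

lemma mem_span_pair: "x \<in> vec.span {p, q} \<longleftrightarrow> (\<exists>s t. x = s *s p + t *s (q :: 'a::field ^ 'n))"
proof
  assume "x \<in> vec.span {p, q}"
  then obtain s where "x - s *s p \<in> vec.span {q}" by (auto simp: vec.span_insert)
  then obtain t where "x - s *s p = t *s q" by (auto simp: vec.span_singleton)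
  then have "x = s *s p + t *s q" by (simp add: diff_eq_eq add.commute)
  then show "\<exists>s t. x = s *s p + t *s q" by blast
next
  assume "\<exists>s t. x = s *s p + t *s q"
  then show "x \<in> vec.span {p, q}" by (auto intro: vec.span_add vec.span_scale vec.span_base)
qed

text \<open>The underlying Hurwitz algebra is \<open>F[y]/(y^2 - d)\<close> with unit
  \<open>f\<close> and norm \<open>s^2 - d t^2\<close>; conjugation negates \<open>y\<close>. The
  norm is nondegenerate because 2 and \<open>d\<close> are nonzero.\<close>

lemma para_quadratic_on_span:
  fixes f y :: "'a::field ^ 'n"
  assumes p: "algebra_product_on UNIV p" and two: "(2::'a) \<noteq> 0"
    and f: "f \<noteq> 0" "p f f = f" and y: "p f y = - y" "p y f = - y" "p y y = d *s f" "d \<noteq> 0"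
  shows "para_quadratic_on (vec.span {f, y}) p"
proof -
  note lin = p[unfolded algebra_product_on_def, simplified]
  define G where "G s t = s *s f + t *s y" for s t
  have G_p: "p (G s t) (G s' t') = G (s * s' + d * (t * t')) (- (s * t' + t * s'))" for s t s' t'
    unfolding G_def using f y by (simp add: lin vec_eq_iff algebra_simps)
  have "s = 0 \<and> t = 0" if 0: "G s t = 0" for s t
  proof -
    \<comment> \<open>Left multiplication by \<open>f\<close> fixes \<open>f\<close> and negates
      \<open>y\<close>, so adding the result to the relation isolates
      \<open>(2 * s) *s f\<close>.\<close>
    have "p f (G s t) = s *s f - t *s y" unfolding G_def by (simp add: lin f y vec_eq_iff)
    moreover have "p f 0 = 0" using lin by (metis vec.scale_zero_left)
    ultimately have "s *s f - t *s y = 0" using 0 by simp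
    then have "G s t + (s *s f - t *s y) = 0" using 0 by simp
    then have "(2 * s) *s f = 0" by (simp add: G_def vec_eq_iff algebra_simps)
    then have "s = 0" using f two by (simp add: vec.scale_eq_0_iff)
    moreover have "t = 0 \<or> y = 0" using 0 \<open>s = 0\<close> by (simp add: G_def vec.scale_eq_0_iff)
    moreover have "y \<noteq> 0"
    proof
      assume "y = 0"
      then have "0 *s p y y = d *s f" using y(3) lin by (metis vec.scale_zero_left)
      then show False using f(1) y(4) by (simp add: vec.scale_eq_0_iff)
    qed
    ultimately show ?thesis by simp
  qed
  note indep = this
  have G_diff: "G s t - G s' t' = G (s - s') (t - t')" for s t s' t'
    by (simp add: G_def vec_eq_iff algebra_simps)
  have G_eq: "G s t = G s' t' \<longleftrightarrow> s = s' \<and> t = t'" for s t s' t'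
    using indep[of "s - s'" "t - t'"] G_diff[of s t s' t'] by auto
  \<comment> \<open>Coordinates with respect to \<open>f\<close> and \<open>y\<close>. Off the span
    \<open>inv\<close> gives arbitrary values, but every axiom speaks of the span.\<close>
  define c where "c = inv (\<lambda>(s, t). G s t)"
  have c: "c (G s t) = (s, t)" for s t
    unfolding c_def by (rule inv_f_eq) (auto simp: inj_def G_eq)
  define N where "N x = (case c x of (s, t) \<Rightarrow> s\<^sup>2 - d * t\<^sup>2)" for x
  define m where "m a b = (case (c a, c b) of ((s, t), (s', t')) \<Rightarrow>
    G (s * s' + d * (t * t')) (s * t' + t * s'))" for a b
  have G_add: "G s t + G s' t' = G (s + s') (t + t')" and G_scale: "k *s G s t = G (k * s) (k * t)"
    for s t s' t' k by (simp_all add: G_def vec_eq_iff algebra_simps)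
  have G_N: "N (G s t) = s\<^sup>2 - d * t\<^sup>2" and
    G_m: "m (G s t) (G s' t') = G (s * s' + d * (t * t')) (s * t' + t * s')" for s t s' t'
    by (simp_all add: N_def m_def c)
  have G_polar: "polar N (G s t) (G s' t') = 2 * (s * s' - d * (t * t'))" for s t s' t'
    by (simp add: polar_def G_add G_N power2_eq_square algebra_simps)
  have f_G: "f = G 1 0" by (simp add: G_def)
  have V: "vec.span {f, y} = {x. \<exists>s t. x = G s t}"
    using mem_span_pair[of _ f y] by (auto simp: G_def)
  have zero: "(0 :: 'a ^ 'n) = G 0 0" by (simp add: G_def)
  have "nondegenerate_on (vec.span {f, y}) N"
    unfolding nondegenerate_on_def
  proof (intro ballI impI)
    fix x assume "x \<in> vec.span {f, y}" and *: "\<forall>z\<in>vec.span {f, y}. polar N x z = 0"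
    then obtain s t where x: "x = G s t" unfolding V by blast
    have "polar N x (G 1 0) = 0" "polar N x (G 0 1) = 0" using * unfolding V by blast+
    then show "x = 0" using two y(4) by (simp add: x G_polar zero)
  qed
  moreover have ball: "(\<forall>x\<in>vec.span {f, y}. P x) \<longleftrightarrow> (\<forall>s t. P (G s t))" for P
    unfolding V by blast
  moreover have "G s t \<in> vec.span {f, y}" for s t unfolding V by blast
  moreover have "m f (G s t) = G s t" "m (G s t) f = G s t" for s t
    using G_m[of 1 0 s t] G_m[of s t 1 0] by (simp_all flip: f_G)
  ultimately have "hurwitz_algebra_on (vec.span {f, y}) m f N"
    unfolding hurwitz_algebra_on_def algebra_product_on_def quadratic_form_on_def
    by (simp add: G_add G_scale G_N G_m G_polar G_eq power2_eq_square algebra_simps vec.span_base)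
  moreover have "hurwitz_conj f N (G s t) = G s (- t)" for s t
    unfolding hurwitz_conj_def f_G by (simp add: G_polar) (simp add: G_def vec_eq_iff)
  moreover have "vec.dim (vec.span {f, y}) = 2"
    using indep by (intro dim_span_pair) (simp add: G_def)
  ultimately show ?thesis
    unfolding para_hurwitz_on_def
    by (intro exI[of _ m] exI[of _ f] exI[of _ N]) (simp add: ball G_p G_m)
qed

section \<open>The Poisson model\<close>

lemma okubo_mult_nth:
  "(a \<star> b) $ Z10 = a $ Z20 * b $ Z20 - a $ Z02 * b $ Z11 - a $ Z22 * b $ Z21 - a $ Z12 * b $ Z01"
  "(a \<star> b) $ Z20 = a $ Z10 * b $ Z10 - a $ Z01 * b $ Z22 - a $ Z11 * b $ Z12 - a $ Z21 * b $ Z02"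
  "(a \<star> b) $ Z01 = a $ Z02 * b $ Z02 - a $ Z10 * b $ Z21 - a $ Z11 * b $ Z20 - a $ Z12 * b $ Z22"
  "(a \<star> b) $ Z02 = a $ Z01 * b $ Z01 - a $ Z20 * b $ Z12 - a $ Z22 * b $ Z10 - a $ Z21 * b $ Z11"
  "(a \<star> b) $ Z11 = a $ Z22 * b $ Z22 - a $ Z10 * b $ Z01 - a $ Z02 * b $ Z12 - a $ Z21 * b $ Z20"
  "(a \<star> b) $ Z22 = a $ Z11 * b $ Z11 - a $ Z20 * b $ Z02 - a $ Z01 * b $ Z21 - a $ Z12 * b $ Z10"
  "(a \<star> b) $ Z12 = a $ Z21 * b $ Z21 - a $ Z20 * b $ Z22 - a $ Z02 * b $ Z10 - a $ Z11 * b $ Z01"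
  "(a \<star> b) $ Z21 = a $ Z12 * b $ Z12 - a $ Z10 * b $ Z11 - a $ Z01 * b $ Z20 - a $ Z22 * b $ Z02"
  by (simp_all add: okubo_mult_def UNIV_okubo_index axis_def algebra_simps)

lemma all_okubo_index: "(\<forall>i. P i) \<longleftrightarrow> P Z10 \<and> P Z20 \<and> P Z01 \<and> P Z02 \<and> P Z11 \<and> P Z22 \<and> P Z12 \<and> P Z21"
  by (metis okubo_index.exhaust)

text \<open>
  The constructors other than \<open>One\<close> name monomials; \<open>One\<close> is the index of \<open>1 - \<omega>\<close>, since the
  elements of the model have trace \<open>f\<^sub>0 + f\<^sub>\<omega> = 0\<close>.
\<close>

datatype tmon = One | U | V | UU | UV | VV | UUV | UVV

lemma UNIV_tmon: "UNIV = {One, U, V, UU, UV, VV, UUV, UVV}"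
  by (auto intro: tmon.exhaust)

instance tmon :: finite
  by standard (simp add: UNIV_tmon)

lemma all_tmon: "(\<forall>i. P i) \<longleftrightarrow> P One \<and> P U \<and> P V \<and> P UU \<and> P UV \<and> P VV \<and> P UUV \<and> P UVV"
  by (metis tmon.exhaust)

type_synonym 'a model = "'a ^ tmon"

text \<open>The product \<open>f g + {f,g} - tr(f g)\<close> multiplied out in the coordinates of
  \<open>tmon\<close>, with coefficients reduced modulo 3.\<close>

definition model_mult :: "'a::field model \<Rightarrow> 'a model \<Rightarrow> 'a model"  (infixl "\<odot>" 70) where
  "a \<odot> b = (\<chi> k. case k of
     One \<Rightarrow> a $ U * b $ V - a $ One * b $ One - a $ U * b $ UVV - a $ V * b $ U - a $ V * b $ UUV - a $ UU * b $ VV - a $ UV * b $ UV - a $ VV * b $ UU - a $ UUV * b $ V - a $ UVV * b $ U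
   | U \<Rightarrow> a $ One * b $ U + a $ U * b $ One + a $ U * b $ UV + a $ V * b $ UU - a $ UU * b $ V - a $ UV * b $ U
   | V \<Rightarrow> a $ One * b $ V + a $ V * b $ One + a $ UV * b $ V + a $ VV * b $ U - a $ U * b $ VV - a $ V * b $ UV
   | UU \<Rightarrow> a $ One * b $ UU + a $ U * b $ U + a $ U * b $ UUV + a $ UU * b $ One + a $ UV * b $ UU - a $ UU * b $ UV - a $ UUV * b $ U
   | UV \<Rightarrow> a $ One * b $ UV + a $ U * b $ V + a $ V * b $ U + a $ V * b $ UUV + a $ UU * b $ VV + a $ UV * b $ One + a $ UVV * b $ U - a $ U * b $ UVV - a $ VV * b $ UU - a $ UUV * b $ V
   | VV \<Rightarrow> a $ One * b $ VV + a $ V * b $ V + a $ VV * b $ One + a $ VV * b $ UV + a $ UVV * b $ V - a $ V * b $ UVV - a $ UV * b $ VV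
   | UUV \<Rightarrow> a $ One * b $ UUV + a $ U * b $ One + a $ U * b $ UV + a $ V * b $ UU + a $ UU * b $ V + a $ UU * b $ UVV + a $ UV * b $ U + a $ UUV * b $ One + a $ UUV * b $ UV - a $ One * b $ U - a $ UV * b $ UUV - a $ UVV * b $ UU
   | UVV \<Rightarrow> a $ One * b $ V + a $ One * b $ UVV + a $ U * b $ VV + a $ V * b $ UV + a $ UV * b $ V + a $ UV * b $ UVV + a $ VV * b $ U + a $ UUV * b $ VV + a $ UVV * b $ One - a $ V * b $ One - a $ VV * b $ UUV - a $ UVV * b $ UV)"

lemma model_mult_nth:
  "(a \<odot> b) $ One = a $ U * b $ V - a $ One * b $ One - a $ U * b $ UVV - a $ V * b $ U - a $ V * b $ UUV - a $ UU * b $ VV - a $ UV * b $ UV - a $ VV * b $ UU - a $ UUV * b $ V - a $ UVV * b $ U"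
  "(a \<odot> b) $ U = a $ One * b $ U + a $ U * b $ One + a $ U * b $ UV + a $ V * b $ UU - a $ UU * b $ V - a $ UV * b $ U"
  "(a \<odot> b) $ V = a $ One * b $ V + a $ V * b $ One + a $ UV * b $ V + a $ VV * b $ U - a $ U * b $ VV - a $ V * b $ UV"
  "(a \<odot> b) $ UU = a $ One * b $ UU + a $ U * b $ U + a $ U * b $ UUV + a $ UU * b $ One + a $ UV * b $ UU - a $ UU * b $ UV - a $ UUV * b $ U"
  "(a \<odot> b) $ UV = a $ One * b $ UV + a $ U * b $ V + a $ V * b $ U + a $ V * b $ UUV + a $ UU * b $ VV + a $ UV * b $ One + a $ UVV * b $ U - a $ U * b $ UVV - a $ VV * b $ UU - a $ UUV * b $ V"
  "(a \<odot> b) $ VV = a $ One * b $ VV + a $ V * b $ V + a $ VV * b $ One + a $ VV * b $ UV + a $ UVV * b $ V - a $ V * b $ UVV - a $ UV * b $ VV"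
  "(a \<odot> b) $ UUV = a $ One * b $ UUV + a $ U * b $ One + a $ U * b $ UV + a $ V * b $ UU + a $ UU * b $ V + a $ UU * b $ UVV + a $ UV * b $ U + a $ UUV * b $ One + a $ UUV * b $ UV - a $ One * b $ U - a $ UV * b $ UUV - a $ UVV * b $ UU"
  "(a \<odot> b) $ UVV = a $ One * b $ V + a $ One * b $ UVV + a $ U * b $ VV + a $ V * b $ UV + a $ UV * b $ V + a $ UV * b $ UVV + a $ VV * b $ U + a $ UUV * b $ VV + a $ UVV * b $ One - a $ V * b $ One - a $ VV * b $ UUV - a $ UVV * b $ UV"
  by (simp_all add: model_mult_def)

text \<open>
  The new coordinates are \<open>u = (x\<^sup>2 - x)(1 + v\<^sup>2)\<close> and \<open>v = (y\<^sup>2 - y)(1 + (x - 1)\<^sup>2)\<close>, for which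
  \<open>dx dy/(x y) = (1 + \<omega>) du dv\<close>; the entries below are the coefficients of their monomials at
  \<open>x\<^sup>i y\<^sup>j\<close>, reduced modulo 3.
\<close>

fun model_basis :: "tmon \<Rightarrow> 'a::field okubo" where
  "model_basis One = (\<chi> i. case i of Z10 \<Rightarrow> -1 | Z20 \<Rightarrow> -1 | Z01 \<Rightarrow> -1 | Z02 \<Rightarrow> -1 | Z11 \<Rightarrow> -1 | Z22 \<Rightarrow> -1 | Z12 \<Rightarrow> -1 | Z21 \<Rightarrow> -1)"
| "model_basis U = (\<chi> i. case i of Z10 \<Rightarrow> 1 | Z20 \<Rightarrow> -1 | Z01 \<Rightarrow> 0 | Z02 \<Rightarrow> 0 | Z11 \<Rightarrow> -1 | Z22 \<Rightarrow> 1 | Z12 \<Rightarrow> -1 | Z21 \<Rightarrow> 1)"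
| "model_basis V = (\<chi> i. case i of Z10 \<Rightarrow> 0 | Z20 \<Rightarrow> 0 | Z01 \<Rightarrow> 1 | Z02 \<Rightarrow> -1 | Z11 \<Rightarrow> -1 | Z22 \<Rightarrow> 1 | Z12 \<Rightarrow> 1 | Z21 \<Rightarrow> -1)"
| "model_basis UU = (\<chi> i. case i of Z10 \<Rightarrow> 0 | Z20 \<Rightarrow> 0 | Z01 \<Rightarrow> -1 | Z02 \<Rightarrow> -1 | Z11 \<Rightarrow> -1 | Z22 \<Rightarrow> -1 | Z12 \<Rightarrow> -1 | Z21 \<Rightarrow> -1)"
| "model_basis UV = (\<chi> i. case i of Z10 \<Rightarrow> 0 | Z20 \<Rightarrow> 0 | Z01 \<Rightarrow> 0 | Z02 \<Rightarrow> 0 | Z11 \<Rightarrow> 1 | Z22 \<Rightarrow> 1 | Z12 \<Rightarrow> -1 | Z21 \<Rightarrow> -1)"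
| "model_basis VV = (\<chi> i. case i of Z10 \<Rightarrow> -1 | Z20 \<Rightarrow> -1 | Z01 \<Rightarrow> 0 | Z02 \<Rightarrow> 0 | Z11 \<Rightarrow> -1 | Z22 \<Rightarrow> -1 | Z12 \<Rightarrow> -1 | Z21 \<Rightarrow> -1)"
| "model_basis UUV = (\<chi> i. case i of Z10 \<Rightarrow> 0 | Z20 \<Rightarrow> 0 | Z01 \<Rightarrow> -1 | Z02 \<Rightarrow> 1 | Z11 \<Rightarrow> -1 | Z22 \<Rightarrow> 1 | Z12 \<Rightarrow> 1 | Z21 \<Rightarrow> -1)"
| "model_basis UVV = (\<chi> i. case i of Z10 \<Rightarrow> -1 | Z20 \<Rightarrow> 1 | Z01 \<Rightarrow> 0 | Z02 \<Rightarrow> 0 | Z11 \<Rightarrow> -1 | Z22 \<Rightarrow> 1 | Z12 \<Rightarrow> -1 | Z21 \<Rightarrow> 1)"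

text \<open>The inverse change of coordinates: the expansion of \<open>x^i y^j\<close> in
  \<open>u\<close> and \<open>v\<close>, where trace 0 determines the coefficient of
  \<open>u^2 v^2\<close>.\<close>

fun okubo_coords :: "okubo_index \<Rightarrow> 'a::field model" where
  "okubo_coords Z10 = (\<chi> k. case k of One \<Rightarrow> 1 | U \<Rightarrow> 1 | V \<Rightarrow> 0 | UU \<Rightarrow> -1 | UV \<Rightarrow> 0 | VV \<Rightarrow> 0 | UUV \<Rightarrow> 0 | UVV \<Rightarrow> -1)"
| "okubo_coords Z20 = (\<chi> k. case k of One \<Rightarrow> 1 | U \<Rightarrow> -1 | V \<Rightarrow> 0 | UU \<Rightarrow> -1 | UV \<Rightarrow> 0 | VV \<Rightarrow> 0 | UUV \<Rightarrow> 0 | UVV \<Rightarrow> 1)"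
| "okubo_coords Z01 = (\<chi> k. case k of One \<Rightarrow> 1 | U \<Rightarrow> 0 | V \<Rightarrow> 1 | UU \<Rightarrow> 0 | UV \<Rightarrow> 0 | VV \<Rightarrow> -1 | UUV \<Rightarrow> -1 | UVV \<Rightarrow> 0)"
| "okubo_coords Z02 = (\<chi> k. case k of One \<Rightarrow> 1 | U \<Rightarrow> 0 | V \<Rightarrow> -1 | UU \<Rightarrow> 0 | UV \<Rightarrow> 0 | VV \<Rightarrow> -1 | UUV \<Rightarrow> 1 | UVV \<Rightarrow> 0)"
| "okubo_coords Z11 = (\<chi> k. case k of One \<Rightarrow> 1 | U \<Rightarrow> 1 | V \<Rightarrow> 1 | UU \<Rightarrow> -1 | UV \<Rightarrow> 1 | VV \<Rightarrow> -1 | UUV \<Rightarrow> 1 | UVV \<Rightarrow> 1)"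
| "okubo_coords Z22 = (\<chi> k. case k of One \<Rightarrow> 1 | U \<Rightarrow> -1 | V \<Rightarrow> -1 | UU \<Rightarrow> -1 | UV \<Rightarrow> 1 | VV \<Rightarrow> -1 | UUV \<Rightarrow> -1 | UVV \<Rightarrow> -1)"
| "okubo_coords Z12 = (\<chi> k. case k of One \<Rightarrow> 1 | U \<Rightarrow> 1 | V \<Rightarrow> -1 | UU \<Rightarrow> -1 | UV \<Rightarrow> -1 | VV \<Rightarrow> -1 | UUV \<Rightarrow> -1 | UVV \<Rightarrow> 1)"
| "okubo_coords Z21 = (\<chi> k. case k of One \<Rightarrow> 1 | U \<Rightarrow> -1 | V \<Rightarrow> 1 | UU \<Rightarrow> -1 | UV \<Rightarrow> -1 | VV \<Rightarrow> -1 | UUV \<Rightarrow> 1 | UVV \<Rightarrow> -1)"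

section \<open>Linear and bilinear maps determined by coordinate vectors\<close>

lemma vec_linearI:
  fixes f :: "'a::field ^ 'n \<Rightarrow> 'a ^ 'm"
  assumes "\<And>x y. f (x + y) = f x + f y" "\<And>c x. f (c *s x) = c *s f x"
  shows "Vector_Spaces.linear (*s) (*s) f"
  unfolding Vector_Spaces.linear_iff by (intro conjI allI assms vec.vector_space_axioms)

definition linear_ext :: "('n::finite \<Rightarrow> 'a::field ^ 'm) \<Rightarrow> 'a ^ 'n \<Rightarrow> 'a ^ 'm" where
  "linear_ext g a = (\<Sum>k\<in>UNIV. a $ k *s g k)"

lemma linear_linear_ext: "Vector_Spaces.linear (*s) (*s) (linear_ext g)"
  by (rule vec_linearI)
    (simp_all add: linear_ext_def sum.distrib vec.scale_left_distrib vec.scale_sum_right)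

lemma linear_ext_axis: "linear_ext g (axis k 1) = g k"
  by (simp add: linear_ext_def axis_def if_distrib[where f = "\<lambda>c. c *s _"] cong: if_cong)

lemma linear_eq_on_axes:
  fixes f g :: "'a::field ^ 'n \<Rightarrow> 'a ^ 'm"
  assumes "Vector_Spaces.linear (*s) (*s) f" "Vector_Spaces.linear (*s) (*s) g"
    and "\<And>i. f (axis i 1) = g (axis i 1)"
  shows "f x = g x"
proof (rule vec.linear_eq_on[OF assms(1,2)])
  show "x \<in> vec.span cart_basis" by simp
  show "\<And>b. b \<in> cart_basis \<Longrightarrow> f b = g b" using assms(3) by (auto simp: cart_basis_def)
qed

lemma algebra_product_linear:
  assumes "algebra_product_on UNIV m"
  shows "Vector_Spaces.linear (*s) (*s) (m x)" "Vector_Spaces.linear (*s) (*s) (\<lambda>x. m x y)"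
  using assms unfolding algebra_product_on_def
  by (intro vec_linearI; blast)+

text \<open>Both sides are bilinear, so each argument in turn reduces to coordinate vectors.
  Homomorphisms thereby become finite checks on pairs of basis elements.\<close>

lemma multiplicative_on_axes:
  fixes g :: "'a::field ^ 'n \<Rightarrow> 'a ^ 'm"
  assumes m: "algebra_product_on UNIV m" and m': "algebra_product_on UNIV m'"
    and g: "Vector_Spaces.linear (*s) (*s) g"
    and "\<And>i j. g (m (axis i 1) (axis j 1)) = m' (g (axis i 1)) (g (axis j 1))"
  shows "g (m x y) = m' (g x) (g y)"
proof -
  note lin = algebra_product_linear[OF m] algebra_product_linear[OF m'] g
  have l1: "Vector_Spaces.linear (*s) (*s) (\<lambda>y. g (m x y))"
    "Vector_Spaces.linear (*s) (*s) (\<lambda>x. g (m x y))"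
    "Vector_Spaces.linear (*s) (*s) (\<lambda>y. m' (g x) (g y))"
    "Vector_Spaces.linear (*s) (*s) (\<lambda>x. m' (g x) (g y))" for x y
    using Vector_Spaces.linear_compose[OF lin(1) lin(5)] Vector_Spaces.linear_compose[OF lin(2) lin(5)]
      Vector_Spaces.linear_compose[OF lin(5) lin(3)] Vector_Spaces.linear_compose[OF lin(5) lin(4)]
    by (simp_all add: o_def)
  have "g (m (axis i 1) y) = m' (g (axis i 1)) (g y)" for i y
    by (rule linear_eq_on_axes[OF l1(1) l1(3)]) (fact assms(4))
  then show ?thesis
    by (rule linear_eq_on_axes[OF l1(2) l1(4)])
qed

lemma algebra_product_okubo: "algebra_product_on UNIV (\<star>)"
  by (simp add: algebra_product_on_def vec_eq_iff all_okubo_index okubo_mult_nth algebra_simps)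

lemma algebra_product_model: "algebra_product_on UNIV (\<odot>)"
  by (simp add: algebra_product_on_def vec_eq_iff all_tmon model_mult_nth algebra_simps)

section \<open>The isomorphism between the model and the Okubo algebra in characteristic 3\<close>

definition of_model :: "'a::field model \<Rightarrow> 'a okubo" where
  "of_model = linear_ext model_basis"

definition to_model :: "'a::field okubo \<Rightarrow> 'a model" where
  "to_model = linear_ext okubo_coords"

lemmas linear_of_model = linear_linear_ext[of model_basis, folded of_model_def]
lemmas linear_to_model = linear_linear_ext[of okubo_coords, folded to_model_def]
lemmas of_model_axis = linear_ext_axis[of model_basis, folded of_model_def]
lemmas to_model_axis = linear_ext_axis[of okubo_coords, folded to_model_def]

locale char_3 =
  fixes ty :: "'a::field itself"
  assumes three: "(3::'a) = 0"
begin

lemma numerals_mod_3: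
  "2 = (-1::'a)" "4 = (1::'a)" "5 = (-1::'a)" "6 = (0::'a)" "7 = (1::'a)" "8 = (-1::'a)" "9 = (0::'a)"
proof -
  have "3 = 2 + (1::'a)" by simp
  then have "2 + (1::'a) = 0" unfolding three by simp
  then show *: "2 = (-1::'a)" by (simp only: eq_neg_iff_add_eq_0)
  have "4 = (3 + 1::'a)" "5 = (3 + 2 :: 'a)" "6 = 3 + (3 :: 'a)" "7 = 3 + 3 + (1 :: 'a)"
      "8 = 3 + 3 + (2 :: 'a)" "9 = 3 + 3 + (3 :: 'a)" by simp_all
  then show "4 = (1::'a)" "5 = (-1::'a)" "6 = (0::'a)" "7 = (1::'a)" "8 = (-1::'a)" "9 = (0::'a)"
    unfolding three * by simp_all
qed

lemmas mod_3 = three numerals_mod_3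

lemma of_model_mult: "of_model (a \<odot> b) = of_model a \<star> of_model (b :: 'a model)"
proof (rule multiplicative_on_axes[OF algebra_product_model algebra_product_okubo linear_of_model])
  show "of_model (axis i 1 \<odot> axis j (1::'a)) = of_model (axis i 1) \<star> of_model (axis j 1)" for i j
    unfolding of_model_axis
    by (cases i; cases j; simp add: vec_eq_iff all_okubo_index okubo_mult_nth of_model_def linear_ext_def UNIV_tmon model_mult_nth axis_def mod_3)
qed

lemma to_of_model [simp]: "to_model (of_model (a :: 'a model)) = a"
proof (rule linear_eq_on_axes[OF _ vec.linear_ident, of "\<lambda>a. to_model (of_model a)"])
  show "Vector_Spaces.linear (*s) (*s) (\<lambda>a :: 'a model. to_model (of_model a))"
    using Vector_Spaces.linear_compose[OF linear_of_model linear_to_model] by (simp add: o_def)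
  show "to_model (of_model (axis i 1)) = (axis i 1 :: 'a model)" for i
    unfolding of_model_axis
    by (cases i; simp add: vec_eq_iff all_tmon to_model_def linear_ext_def UNIV_okubo_index axis_def mod_3)
qed

lemma of_to_model [simp]: "of_model (to_model (x :: 'a okubo)) = x"
proof (rule linear_eq_on_axes[OF _ vec.linear_ident, of "\<lambda>a. of_model (to_model a)"])
  show "Vector_Spaces.linear (*s) (*s) (\<lambda>a :: 'a okubo. of_model (to_model a))"
    using Vector_Spaces.linear_compose[OF linear_to_model linear_of_model] by (simp add: o_def)
  show "of_model (to_model (axis i 1)) = (axis i 1 :: 'a okubo)" for i
    unfolding to_model_axis
    by (cases i; simp add: vec_eq_iff all_okubo_index of_model_def linear_ext_def UNIV_tmon axis_def mod_3)
qed
end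
section \<open>Automorphisms\<close>

context char_3
begin

text \<open>Conjugating by the isomorphism turns a multiplicative change of basis of the model into
  an automorphism of the Okubo algebra; \<open>g'\<close> supplies its inverse.\<close>

lemma same_orbit_linear_ext:
  fixes g g' :: "tmon \<Rightarrow> 'a model"
  assumes mult: "\<And>i j. linear_ext g (axis i 1 \<odot> axis j 1) = g i \<odot> g j"
    and inv: "\<And>i. linear_ext g (g' i) = axis i 1" "\<And>i. linear_ext g' (g i) = axis i 1"
  shows "same_orbit (of_model a) (of_model (linear_ext g a))"
proof -
  define f where "f = of_model \<circ> (linear_ext g \<circ> to_model)"
  define f' where "f' = of_model \<circ> (linear_ext g' \<circ> to_model)"
  have lin: "Vector_Spaces.linear (*s) (*s) f"
    unfolding f_def
    by (rule Vector_Spaces.linear_compose[OF Vector_Spaces.linear_compose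
          [OF linear_to_model linear_linear_ext] linear_of_model])
  have inverse: "linear_ext h (linear_ext h' x) = x"
    if "\<And>i. linear_ext h (h' i) = axis i 1" for h h' :: "tmon \<Rightarrow> 'a model" and x
    by (rule linear_eq_on_axes[OF _ vec.linear_ident, of "\<lambda>x. linear_ext h (linear_ext h' x)"])
      (use that Vector_Spaces.linear_compose[OF linear_linear_ext[of h'] linear_linear_ext[of h]]
        in \<open>simp_all add: o_def linear_ext_axis\<close>)
  have "f \<circ> f' = id" "f' \<circ> f = id"
    by (simp_all add: fun_eq_iff f_def f'_def inverse[OF inv(1)] inverse[OF inv(2)])
  then have "bij f" by (metis o_bij)
  moreover have "f (x \<star> y) = f x \<star> f y" for x y
  proof -
    have "linear_ext g (a \<odot> b) = linear_ext g a \<odot> linear_ext g b" for a b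
      by (rule multiplicative_on_axes[OF algebra_product_model algebra_product_model linear_linear_ext])
        (simp add: mult linear_ext_axis)
    moreover have "to_model (x \<star> y) = to_model x \<odot> to_model y"
      by (metis of_model_mult of_to_model to_of_model)
    ultimately show ?thesis by (simp add: f_def of_model_mult)
  qed
  ultimately have "okubo_automorphism f" using lin by (simp add: okubo_automorphism_def)
  moreover have "f (of_model a) = of_model (linear_ext g a)" by (simp add: f_def)
  ultimately show ?thesis unfolding same_orbit_def by blast
qed

text \<open>
  The following families are the substitutions \<open>(u, v) \<mapsto> (s u, v/s)\<close>, \<open>(s v, - s u)\<close> for
  \<open>s = \<plusminus>1\<close>, \<open>(u + c v + d v\<^sup>2, v)\<close> and \<open>(u/(1 + c v), v - c v\<^sup>2)\<close>.  They fix \<open>\<omega>\<close> and have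
  Jacobian determinant 1.
\<close>

fun torus :: "'a \<Rightarrow> tmon \<Rightarrow> 'a model" where
  "torus s One = axis One 1"
| "torus s U = axis U s"
| "torus s V = axis V (inverse s)"
| "torus s UU = axis UU (s\<^sup>2)"
| "torus s UV = axis UV 1"
| "torus s VV = axis VV ((inverse s)\<^sup>2)"
| "torus s UUV = axis UUV s"
| "torus s UVV = axis UVV (inverse s)"

fun rotation :: "'a \<Rightarrow> tmon \<Rightarrow> 'a model" where
  "rotation s One = axis One 1"
| "rotation s U = axis V s"
| "rotation s V = axis U (- s)"
| "rotation s UU = axis VV 1"
| "rotation s UV = axis UV (-1)"
| "rotation s VV = axis UU 1"
| "rotation s UUV = axis UVV (- s)"
| "rotation s UVV = axis UUV s"

fun shear :: "'a \<Rightarrow> 'a \<Rightarrow> tmon \<Rightarrow> 'a model" where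
  "shear c d One = axis One 1"
| "shear c d U = axis U 1 + axis V c + axis VV d"
| "shear c d V = axis V 1"
| "shear c d UU = axis UU 1 + axis UV (- c) + axis VV (c\<^sup>2) + axis UVV (- d)"
| "shear c d UV = axis UV 1 + axis VV c"
| "shear c d VV = axis VV 1"
| "shear c d UUV = axis UUV 1 + axis UVV (- c)"
| "shear c d UVV = axis UVV 1"

fun twist :: "'a \<Rightarrow> tmon \<Rightarrow> 'a model" where
  "twist c One = axis One 1"
| "twist c U = axis U 1 + axis UV (- c) + axis UVV (c\<^sup>2)"
| "twist c V = axis V 1 + axis VV (- c)"
| "twist c UU = axis UU 1 + axis UUV c"
| "twist c UV = axis UV 1 + axis UVV c"
| "twist c VV = axis VV 1"
| "twist c UUV = axis UUV 1"
| "twist c UVV = axis UVV 1"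

lemma same_orbit_torus: "s \<noteq> 0 \<Longrightarrow> same_orbit (of_model a) (of_model (linear_ext (torus s) a))"
proof (rule same_orbit_linear_ext[of _ "torus (inverse s)"])
  assume s: "s \<noteq> 0"
  show "linear_ext (torus s) (axis i 1 \<odot> axis j 1) = torus s i \<odot> torus s j" for i j
    by (cases i; cases j; simp add: s vec_eq_iff all_tmon linear_ext_def UNIV_tmon model_mult_nth axis_def mod_3 field_simps power2_eq_square)
  show "linear_ext (torus s) (torus (inverse s) i) = axis i 1" for i
    by (cases i; simp add: s vec_eq_iff all_tmon linear_ext_def UNIV_tmon axis_def field_simps)
  show "linear_ext (torus (inverse s)) (torus s i) = axis i 1" for i
    by (cases i; simp add: s vec_eq_iff all_tmon linear_ext_def UNIV_tmon axis_def field_simps)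
qed

lemma same_orbit_rotation: "same_orbit (of_model a) (of_model (linear_ext (rotation 1) a))"
proof (rule same_orbit_linear_ext[of _ "rotation (-1)"])
  show "linear_ext (rotation 1) (axis i 1 \<odot> axis j 1) = rotation 1 i \<odot> rotation 1 j" for i j
    by (cases i; cases j; simp add: vec_eq_iff all_tmon linear_ext_def UNIV_tmon model_mult_nth axis_def mod_3)
  show "linear_ext (rotation 1) (rotation (-1) i) = axis i 1" for i
    by (cases i; simp add: vec_eq_iff all_tmon linear_ext_def UNIV_tmon axis_def)
  show "linear_ext (rotation (-1)) (rotation 1 i) = axis i 1" for i
    by (cases i; simp add: vec_eq_iff all_tmon linear_ext_def UNIV_tmon axis_def)
qed

lemma same_orbit_shear: "same_orbit (of_model a) (of_model (linear_ext (shear c d) a))"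
proof (rule same_orbit_linear_ext[of _ "shear (- c) (- d)"])
  show "linear_ext (shear c d) (axis i 1 \<odot> axis j 1) = shear c d i \<odot> shear c d j" for i j
    by (cases i; cases j; simp add: vec_eq_iff all_tmon linear_ext_def UNIV_tmon model_mult_nth axis_def mod_3 algebra_simps power2_eq_square)
  show "linear_ext (shear c d) (shear (- c) (- d) i) = axis i 1" for i
    by (cases i; simp add: vec_eq_iff all_tmon linear_ext_def UNIV_tmon axis_def mod_3 algebra_simps power2_eq_square)
  show "linear_ext (shear (- c) (- d)) (shear c d i) = axis i 1" for i
    by (cases i; simp add: vec_eq_iff all_tmon linear_ext_def UNIV_tmon axis_def mod_3 algebra_simps power2_eq_square)
qed

text \<open>The derivative of \<open>v - c v^2\<close> is \<open>1 - 2 c v = 1 + c v\<close>, which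
  the denominator of the first component cancels. Negating \<open>c\<close> inverts the
  substitution.\<close>

lemma same_orbit_twist: "same_orbit (of_model a) (of_model (linear_ext (twist c) a))"
proof (rule same_orbit_linear_ext[of _ "twist (- c)"])
  show "linear_ext (twist c) (axis i 1 \<odot> axis j 1) = twist c i \<odot> twist c j" for i j
    by (cases i; cases j; simp add: vec_eq_iff all_tmon linear_ext_def UNIV_tmon model_mult_nth axis_def mod_3 algebra_simps power2_eq_square)
  show "linear_ext (twist c) (twist (- c) i) = axis i 1" for i
    by (cases i; simp add: vec_eq_iff all_tmon linear_ext_def UNIV_tmon axis_def mod_3 algebra_simps power2_eq_square)
  show "linear_ext (twist (- c)) (twist c i) = axis i 1" for i
    by (cases i; simp add: vec_eq_iff all_tmon linear_ext_def UNIV_tmon axis_def mod_3 algebra_simps power2_eq_square)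
qed

end

section \<open>Transitivity and symmetry of the orbit relation\<close>

lemma same_orbit_trans: "same_orbit x y \<Longrightarrow> same_orbit y z \<Longrightarrow> same_orbit x z"
proof -
  assume "same_orbit x y" "same_orbit y z"
  then obtain f g where fg: "okubo_automorphism f" "f x = y" "okubo_automorphism g" "g y = z"
    unfolding same_orbit_def by blast
  then have "okubo_automorphism (g \<circ> f)"
    unfolding okubo_automorphism_def by (auto intro: bij_comp Vector_Spaces.linear_compose)
  then show ?thesis unfolding same_orbit_def using fg by (intro exI[of _ "g \<circ> f"]) simp
qed

lemma same_orbit_sym: "same_orbit x y \<Longrightarrow> same_orbit y x"
proof -
  assume "same_orbit x y"
  then obtain f where f: "okubo_automorphism f" "f x = y" unfolding same_orbit_def by blast
  then have bij: "bij f" and mult: "\<And>a b. f (a \<star> b) = f a \<star> f b"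
    and add: "\<And>a b. f (a + b) = f a + f b" and scale: "\<And>c a. f (c *s a) = c *s f a"
    unfolding okubo_automorphism_def Vector_Spaces.linear_iff by blast+
  have inv: "inv f w = a \<longleftrightarrow> w = f a" for a w
    using bij by (metis bij_inv_eq_iff)
  have ff: "f (inv f a) = a" for a using inv by metis
  have "okubo_automorphism (inv f)"
    unfolding okubo_automorphism_def
    by (intro conjI vec_linearI bij_imp_bij_inv bij allI; simp only: inv add scale mult ff)
  moreover have "inv f y = x" using f(2) inv by simp
  ultimately show ?thesis unfolding same_orbit_def by blast
qed

section \<open>Square-zero elements, idempotents and centralizers in the model\<close>

context char_3
begin

lemma two_neq_0: "(2::'a) \<noteq> 0"
  unfolding mod_3 by simp

text \<open>If the \<open>One\<close> coordinate is nonzero, the equations kill the linear part,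
  then the quadratic part, then that coordinate itself. Since 4 = 1, the last condition says that
  the discriminant of the quadratic part vanishes.\<close>

lemma model_square_zero_iff:
  fixes a :: "'a model"
  shows "a \<odot> a = 0 \<longleftrightarrow> a $ One = 0 \<and> a $ U = 0 \<and> a $ V = 0 \<and> (a $ UV)\<^sup>2 = a $ UU * a $ VV"
proof
  assume *: "a \<odot> a = 0"
  have eqs: "a $ One * a $ U = 0" "a $ One * a $ V = 0"
    "a $ U * a $ U = a $ One * a $ UU" "a $ V * a $ V = a $ One * a $ VV"
    "a $ U * a $ V = - (a $ One * a $ UV)"
    "a $ One * a $ One = a $ UU * a $ VV - (a $ UV)\<^sup>2 + a $ U * a $ UVV + a $ V * a $ UUV"
    using *[unfolded vec_eq_iff all_tmon]
    by (simp_all add: model_mult_nth mod_3 power2_eq_square algebra_simps)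
  show "a $ One = 0 \<and> a $ U = 0 \<and> a $ V = 0 \<and> (a $ UV)\<^sup>2 = a $ UU * a $ VV"
    using eqs by (cases "a $ One = 0") auto
qed (simp add: vec_eq_iff all_tmon model_mult_nth mod_3 power2_eq_square algebra_simps)

text \<open>Each equation equates \<open>a $ One + 1\<close> times a coordinate with products of
  other coordinates. If this factor is nonzero, all coordinates vanish degree by degree; if it is
  zero, the conditions for a square-zero element remain.\<close>

lemma model_idempotent_iff:
  fixes a :: "'a model"
  shows "a \<noteq> 0 \<and> a \<odot> a = a \<longleftrightarrow>
    a $ One = -1 \<and> a $ U = 0 \<and> a $ V = 0 \<and> (a $ UV)\<^sup>2 = a $ UU * a $ VV"
proof
  assume *: "a \<noteq> 0 \<and> a \<odot> a = a"
  have eq: "(a \<odot> a) $ k = a $ k" for k using * by simp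
  have eq0: "(a $ One + 1) * a $ U = 0"
    using eq[of U] by (simp add: model_mult_nth mod_3 algebra_simps neg_eq_iff_add_eq_0)
  have eq1: "(a $ One + 1) * a $ V = 0"
    using eq[of V] by (simp add: model_mult_nth mod_3 algebra_simps neg_eq_iff_add_eq_0)
  have eq2: "(a $ One + 1) * a $ UU = a $ U * a $ U"
    using eq[of UU] by (simp add: model_mult_nth mod_3 power2_eq_square algebra_simps)
  have eq3: "(a $ One + 1) * a $ VV = a $ V * a $ V"
    using eq[of VV] by (simp add: model_mult_nth mod_3 power2_eq_square algebra_simps)
  have eq4: "(a $ One + 1) * a $ UV = - (a $ U * a $ V)"
    using eq[of UV] by (simp add: model_mult_nth mod_3 power2_eq_square algebra_simps) (algebra)
  have eq5: "(a $ One + 1) * a $ UUV = - (a $ U * a $ UV + a $ UU * a $ V)"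
    using eq[of UUV] by (simp add: model_mult_nth mod_3 power2_eq_square algebra_simps) (algebra)
  have eq6: "(a $ One + 1) * a $ UVV = - (a $ U * a $ VV + a $ UV * a $ V)"
    using eq[of UVV] by (simp add: model_mult_nth mod_3 power2_eq_square algebra_simps) (algebra)
  have eq7: "(a $ One + 1) * a $ One = a $ UU * a $ VV - (a $ UV)\<^sup>2 + a $ U * a $ UVV + a $ V * a $ UUV"
    using eq[of One] by (simp add: model_mult_nth mod_3 power2_eq_square algebra_simps)
  note eqs = eq0 eq1 eq2 eq3 eq4 eq5 eq6 eq7
  show "a $ One = -1 \<and> a $ U = 0 \<and> a $ V = 0 \<and> (a $ UV)\<^sup>2 = a $ UU * a $ VV"
  proof (cases "a $ One + 1 = 0")
    case True
    then show ?thesis using eqs by (auto simp: eq_neg_iff_add_eq_0)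
  next
    case False
    then have "a = 0" using eqs by (auto simp: vec_eq_iff all_tmon)
    then show ?thesis using * by simp
  qed
next
  assume *: "a $ One = -1 \<and> a $ U = 0 \<and> a $ V = 0 \<and> (a $ UV)\<^sup>2 = a $ UU * a $ VV"
  then have "a \<noteq> 0" by auto
  moreover have "a \<odot> a = a"
    using * by (simp add: vec_eq_iff all_tmon model_mult_nth mod_3 power2_eq_square algebra_simps)
  ultimately show "a \<noteq> 0 \<and> a \<odot> a = a" ..
qed

text \<open>The commutator is twice the Poisson bracket, so these are its coordinates from
  \<open>U\<close> to \<open>UVV\<close> when \<open>a\<close> has no linear part.\<close>

lemma model_commute:
  fixes a b :: "'a model"
  assumes "a \<odot> b = b \<odot> a" "a $ U = 0" "a $ V = 0"
  shows "a $ UU * b $ V + a $ UV * b $ U = 0"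
    "a $ UV * b $ V + a $ VV * b $ U = 0"
    "a $ UV * b $ UU - a $ UU * b $ UV - a $ UUV * b $ U = 0"
    "a $ UU * b $ VV - a $ VV * b $ UU - a $ UUV * b $ V + a $ UVV * b $ U = 0"
    "a $ VV * b $ UV - a $ UV * b $ VV + a $ UVV * b $ V = 0"
    "a $ UU * b $ UVV - a $ UV * b $ UUV + a $ UUV * b $ UV - a $ UVV * b $ UU = a $ One * b $ U"
    "a $ UV * b $ UVV - a $ VV * b $ UUV + a $ UUV * b $ VV - a $ UVV * b $ UV = - (a $ One * b $ V)"
proof -
  have eq: "(b \<odot> a - a \<odot> b) $ k = 0" for k using assms(1) by simp
  show first: "a $ UU * b $ V + a $ UV * b $ U = 0"
    using eq[of U] assms(2,3) by (simp add: model_mult_nth mod_3 algebra_simps neg_eq_iff_add_eq_0)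
  show second: "a $ UV * b $ V + a $ VV * b $ U = 0"
    using eq[of V] assms(2,3) by (simp add: model_mult_nth mod_3 algebra_simps)
  show "a $ UV * b $ UU - a $ UU * b $ UV - a $ UUV * b $ U = 0"
    "a $ UU * b $ VV - a $ VV * b $ UU - a $ UUV * b $ V + a $ UVV * b $ U = 0"
    "a $ VV * b $ UV - a $ UV * b $ VV + a $ UVV * b $ V = 0"
    using eq[of UU] eq[of UV] eq[of VV] assms(2,3) by (simp_all add: model_mult_nth mod_3 algebra_simps)
  show "a $ UU * b $ UVV - a $ UV * b $ UUV + a $ UUV * b $ UV - a $ UVV * b $ UU = a $ One * b $ U"
    using eq[of UUV] assms(2,3) first by (simp add: model_mult_nth mod_3 algebra_simps) algebra
  show "a $ UV * b $ UVV - a $ VV * b $ UUV + a $ UUV * b $ VV - a $ UVV * b $ UV = - (a $ One * b $ V)"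
    using eq[of UVV] assms(2,3) second by (simp add: model_mult_nth mod_3 algebra_simps)
qed

text \<open>In the sum of the two products the bracket cancels, and the sum is \<open>x\<close>
  because -2 = 1. If \<open>x $ One\<close> were nonzero, the quadratic and then the cubic
  coordinates of \<open>u\<close> would vanish, and the \<open>One\<close> coordinate would read
  \<open>2 * x $ One = x $ One\<close>.\<close>

lemma model_imaginary:
  fixes u x :: "'a model"
  assumes u: "u $ One = -1" "u $ U = 0" "u $ V = 0" and x: "u \<odot> x = - x" "x \<odot> u = - x"
  shows "x $ One = 0"
proof (rule ccontr)
  assume x0: "x $ One \<noteq> 0"
  have eq: "(u \<odot> x + x \<odot> u) $ k = x $ k" for k
    using x by (simp add: mod_3 flip: mult_2)
  have "x $ One * u $ UU = 0" "x $ One * u $ UV = 0" "x $ One * u $ VV = 0"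
    using eq[of UU] eq[of UV] eq[of VV] u by (simp_all add: model_mult_nth mod_3 algebra_simps)
  moreover have "x $ One * u $ UUV = 0" "x $ One * u $ UVV = 0"
    using eq[of UUV] eq[of UVV] u calculation x0 by (simp_all add: model_mult_nth mod_3 algebra_simps)
  ultimately show False
    using eq[of One] u x0 two_neq_0 by (simp add: model_mult_nth mod_3 algebra_simps)
qed

text \<open>The cubic part of \<open>a\<close> first forces the linear part of \<open>x\<close> to
  vanish. Then \<open>(x $ UU, x $ UV)\<close> and \<open>(x $ UV, x $ VV)\<close> are both
  proportional to \<open>(a $ UUV, a $ UVV)\<close>, so the discriminant is 0.\<close>

lemma model_square_zero_if_commute_first:
  fixes a x :: "'a model"
  assumes comm: "a \<odot> x = x \<odot> a"
    and a: "a $ U = 0" "a $ V = 0" "a $ UU = 0" "a $ UV = 0" "a $ VV = 0" "a $ UUV \<noteq> 0 \<or> a $ UVV \<noteq> 0"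
    and x: "x $ One = 0"
  shows "x \<odot> x = 0"
proof -
  have xUV: "x $ U = 0" "x $ V = 0"
    using model_commute(3-5)[OF comm] a by auto
  have "a $ UUV * x $ UV = a $ UVV * x $ UU" "a $ UUV * x $ VV = a $ UVV * x $ UV"
    using model_commute(6,7)[OF comm] a xUV by auto
  then have "a $ UUV * ((x $ UV)\<^sup>2 - x $ UU * x $ VV) = 0" "a $ UVV * ((x $ UV)\<^sup>2 - x $ UU * x $ VV) = 0"
    by algebra+
  then have "(x $ UV)\<^sup>2 = x $ UU * x $ VV" using a(6) by auto
  then show ?thesis using x xUV model_square_zero_iff by blast
qed

text \<open>Commuting with \<open>a\<close> confines the linear part of \<open>x\<close> to a line,
  on which the chosen coordinate is injective. Once it vanishes, the quadratic part of
  \<open>x\<close> is proportional to that of \<open>a\<close>.\<close>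

lemma model_square_zero_if_commute_second:
  fixes a x :: "'a model"
  assumes comm: "a \<odot> x = x \<odot> a"
    and a: "a $ U = 0" "a $ V = 0" "(a $ UV)\<^sup>2 = a $ UU * a $ VV" "a $ UU \<noteq> 0 \<or> a $ VV \<noteq> 0"
    and x: "x $ One = 0" "x $ (if a $ UU = 0 then V else U) = 0"
  shows "x $ U = 0" "x $ V = 0" "x \<odot> x = 0"
proof -
  show xUV: "x $ U = 0" "x $ V = 0"
    using model_commute(1,2)[OF comm] a x by (auto split: if_splits)
  have "a $ UV * x $ UU = a $ UU * x $ UV" "a $ UU * x $ VV = a $ VV * x $ UU" "a $ VV * x $ UV = a $ UV * x $ VV"
    using model_commute(3-5)[OF comm] a xUV by auto
  then have "(a $ UU)\<^sup>2 * ((x $ UV)\<^sup>2 - x $ UU * x $ VV) = 0" "(a $ VV)\<^sup>2 * ((x $ UV)\<^sup>2 - x $ UU * x $ VV) = 0"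
    using a(3) by algebra+
  then have "(x $ UV)\<^sup>2 = x $ UU * x $ VV" using a(4) by auto
  then show "x \<odot> x = 0" using x xUV model_square_zero_iff by blast
qed

end

section \<open>Normal forms of square-zero elements under automorphisms\<close>

context char_3
begin

text \<open>A shear clears the \<open>UVV\<close> coordinate and the torus scales \<open>UUV\<close>
  to 1; the rotation covers the case where \<open>UUV\<close> vanishes.\<close>

lemma normal_form_first:
  fixes a :: "'a model"
  assumes a: "a $ One = 0" "a $ U = 0" "a $ V = 0" "a $ UU = 0" "a $ UV = 0" "a $ VV = 0"
    and ne: "a \<noteq> 0"
  shows "same_orbit (of_model a) (of_model (axis UUV 1))"
proof -
  have main: "same_orbit (of_model a) (of_model (axis UUV 1))"
    if "a $ One = 0" "a $ U = 0" "a $ V = 0" "a $ UU = 0" "a $ UV = 0" "a $ VV = 0" "a $ UUV \<noteq> 0"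
    for a :: "'a model"
  proof -
    have "linear_ext (shear (a $ UVV / a $ UUV) 0) a = axis UUV (a $ UUV)"
      using that by (simp add: vec_eq_iff all_tmon linear_ext_def UNIV_tmon axis_def)
    moreover have "linear_ext (torus (inverse (a $ UUV))) (axis UUV (a $ UUV)) = axis UUV 1"
      using that by (simp add: vec_eq_iff all_tmon linear_ext_def UNIV_tmon axis_def)
    ultimately show ?thesis
      using same_orbit_trans[OF same_orbit_shear[of a "a $ UVV / a $ UUV" 0] same_orbit_torus[of "inverse (a $ UUV)"]]
        that by simp
  qed
  show ?thesis
  proof (cases "a $ UUV = 0")
    case False
    then show ?thesis using a main by blast
  next
    case True
    then have "a $ UVV \<noteq> 0" using a ne by (auto simp: vec_eq_iff all_tmon)
    then have "same_orbit (of_model (linear_ext (rotation 1) a)) (of_model (axis UUV 1))"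
      using a by (intro main) (simp_all add: linear_ext_def UNIV_tmon axis_def)
    then show ?thesis using same_orbit_rotation same_orbit_trans by blast
  qed
qed

lemma normal_form_second:
  fixes a :: "'a model"
  assumes closed: "\<forall>p :: 'a poly. degree p > 0 \<longrightarrow> (\<exists>r. poly p r = 0)"
    and a: "a $ One = 0" "a $ U = 0" "a $ V = 0" "(a $ UV)\<^sup>2 = a $ UU * a $ VV" "a $ UU \<noteq> 0 \<or> a $ VV \<noteq> 0"
  shows "same_orbit (of_model a) (of_model (axis UU 1))"
proof -
  have main: "same_orbit (of_model a) (of_model (axis UU 1))"
    if a: "a $ One = 0" "a $ U = 0" "a $ V = 0" "(a $ UV)\<^sup>2 = a $ UU * a $ VV" "a $ UU \<noteq> 0"
    for a :: "'a model"
  proof -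
    \<comment> \<open>The shear with \<open>c\<close> and \<open>d\<close> clears \<open>UV\<close>
      and \<open>UVV\<close>, the twist with \<open>k\<close> clears \<open>UUV\<close>. The shear
      leaves \<open>3 * c^2 * a $ UU = 0\<close> at \<open>VV\<close>.\<close>
    define c where "c = a $ UV / a $ UU"
    define d where "d = (a $ UVV - c * a $ UUV) / a $ UU"
    define k where "k = - (a $ UUV / a $ UU)"
    define b where "b = axis UU (a $ UU) + axis UUV (a $ UUV)"
    have cd: "a $ UV = c * a $ UU" "a $ UVV = d * a $ UU + c * a $ UUV" "a $ UUV = - (k * a $ UU)"
      using a(5) by (simp_all add: c_def d_def k_def)
    have VV: "a $ VV = c\<^sup>2 * a $ UU"
      using a(4,5) unfolding cd by (simp add: power2_eq_square mult.assoc)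
    have b: "linear_ext (shear c d) a = b"
      using a(1-3) VV cd unfolding b_def
      by (simp add: vec_eq_iff all_tmon linear_ext_def UNIV_tmon axis_def mod_3 power2_eq_square algebra_simps)
    have "linear_ext (twist k) b = axis UU (a $ UU)"
      unfolding b_def using cd(3)
      by (simp add: vec_eq_iff all_tmon linear_ext_def UNIV_tmon axis_def)
    moreover obtain s where s: "s\<^sup>2 * a $ UU = 1"
    proof -
      \<comment> \<open>Algebraic closedness supplies the square root by which the torus scales
        \<open>UU\<close> to 1.\<close>
      have "degree [:- inverse (a $ UU), 0, 1:] > 0" by simp
      then obtain s where "poly [:- inverse (a $ UU), 0, 1:] s = 0" using closed by blast
      then have "s\<^sup>2 = inverse (a $ UU)" by (simp add: power2_eq_square)
      then have "s\<^sup>2 * a $ UU = 1" using a(5) by simp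
      then show thesis by (rule that)
    qed
    moreover have "linear_ext (torus s) (axis UU (a $ UU)) = axis UU 1"
      using s by (simp add: vec_eq_iff all_tmon linear_ext_def UNIV_tmon axis_def mult.commute)
    moreover have "s \<noteq> 0" using s by auto
    ultimately show ?thesis
      using same_orbit_shear[of a c d] same_orbit_twist[of b k] same_orbit_torus[of s "axis UU (a $ UU)"] b
      by (metis same_orbit_trans)
  qed
  show ?thesis
  proof (cases "a $ UU = 0")
    case False
    then show ?thesis using a main by blast
  next
    case True
    then have "a $ VV \<noteq> 0" "a $ UV = 0" using a by auto
    then have "same_orbit (of_model (linear_ext (rotation 1) a)) (of_model (axis UU 1))"
      using a True by (intro main) (simp_all add: linear_ext_def UNIV_tmon axis_def)
    then show ?thesis using same_orbit_rotation same_orbit_trans by blast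
  qed
qed

end

section \<open>Para-Hurwitz subalgebras of centralizers\<close>

lemma polar_linear_ext:
  assumes "\<And>x y z. B (x + y) z = B x z + B y z" "\<And>c x z. B (c *s x) z = c * B x z"
  shows "B (linear_ext g a) z = (\<Sum>k\<in>UNIV. a $ k * B (g k) z)"
proof -
  have B_0: "B 0 z = 0" using assms(2)[of 0 0 z] by simp
  have "B (\<Sum>k\<in>S. a $ k *s g k) z = (\<Sum>k\<in>S. a $ k * B (g k) z)" if "finite S" for S
    using that by (induction S rule: finite_induct) (simp_all add: assms B_0)
  then show ?thesis by (simp add: linear_ext_def)
qed

lemma polar_okubo_norm:
  "polar okubo_norm x y = x $ Z10 * y $ Z20 + x $ Z20 * y $ Z10 + x $ Z01 * y $ Z02 + x $ Z02 * y $ Z01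
    + x $ Z11 * y $ Z22 + x $ Z22 * y $ Z11 + x $ Z12 * y $ Z21 + x $ Z21 * y $ Z12"
  by (simp add: polar_def okubo_norm_def algebra_simps)

context char_3
begin

lemma of_model_simps:
  "of_model (a + b) = of_model a + of_model (b :: 'a model)"
  "of_model (c *s a) = c *s of_model a"
  "of_model 0 = (0 :: 'a okubo)"
  "of_model (- a) = - of_model a"
  using linear_of_model[unfolded Vector_Spaces.linear_iff]
  by (auto simp: vec.linear_0[OF linear_of_model] vec.linear_neg[OF linear_of_model])

lemma to_model_simps:
  "to_model (x + y) = to_model x + to_model (y :: 'a okubo)"
  "to_model (c *s x) = c *s to_model x"
  using linear_to_model[unfolded Vector_Spaces.linear_iff] by auto

lemma of_model_eq_iff: "of_model a = of_model b \<longleftrightarrow> a = (b :: 'a model)"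
  by (metis to_of_model)

lemma of_model_in_centralizer:
  "of_model b \<in> centralizer (of_model a) \<longleftrightarrow> a \<odot> b = b \<odot> (a :: 'a model)"
  by (simp add: centralizer_def flip: of_model_mult) (auto simp: of_model_eq_iff)

text \<open>This is \<open>tr(f g)\<close> in the model: the polar form pairs \<open>x^i y^j\<close>
  with its inverse monomial.\<close>

lemma polar_of_model:
  fixes a b :: "'a model"
  shows "polar okubo_norm (of_model a) (of_model b) =
    - (a $ One * b $ One) + a $ UU * b $ VV + a $ VV * b $ UU + a $ UV * b $ UV
    + a $ UUV * b $ V + a $ V * b $ UUV + a $ UVV * b $ U + a $ U * b $ UVV"
proof -
  have left: "polar okubo_norm (of_model a) y = (\<Sum>k\<in>UNIV. a $ k * polar okubo_norm (model_basis k) y)"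
    for a :: "'a model" and y
    unfolding of_model_def
    by (rule polar_linear_ext) (simp_all add: polar_okubo_norm algebra_simps)
  have "polar okubo_norm (of_model a) (of_model b) =
      (\<Sum>k\<in>UNIV. a $ k * (\<Sum>l\<in>UNIV. b $ l * polar okubo_norm (model_basis l) (model_basis k)))"
    unfolding left polar_commute[of _ "model_basis _" "of_model b"] ..
  then show ?thesis
    by (simp add: UNIV_tmon polar_okubo_norm mod_3 algebra_simps)
qed

text \<open>The unit \<open>u\<close>, which may differ from \<open>of_model a\<close>, is an
  idempotent, so its imaginary elements have no \<open>One\<close> coordinate. As their squares are
  \<open>- N x *s u\<close>, square zero means norm 0.\<close>

lemma para_hurwitz_in_centralizer:
  fixes a :: "'a model"
  assumes para: "para_hurwitz_on d S (\<star>)" "0 < d" and S: "S \<subseteq> centralizer (of_model a)"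
  obtains u N where "vec.subspace S" "vec.dim S = d" "u \<in> S"
    "quadratic_form_on S N" "nondegenerate_on S N" "N u = 1"
    "\<And>x. x \<in> S \<Longrightarrow> polar N x u = 0 \<Longrightarrow> a \<odot> to_model x = to_model x \<odot> a \<and> to_model x $ One = 0
      \<and> (to_model x \<odot> to_model x = 0 \<longrightarrow> N x = 0)"
proof -
  from para obtain u N where *: "vec.subspace S" "vec.dim S = d" "u \<in> S" "u \<noteq> 0" "u \<star> u = u"
    "quadratic_form_on S N" "nondegenerate_on S N" "N u = 1"
    and im: "\<And>x. x \<in> S \<Longrightarrow> polar N x u = 0 \<Longrightarrow> u \<star> x = - x"
      "\<And>x. x \<in> S \<Longrightarrow> polar N x u = 0 \<Longrightarrow> x \<star> u = - x"
      "\<And>x. x \<in> S \<Longrightarrow> polar N x u = 0 \<Longrightarrow> x \<star> x = - N x *s u"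
    by (rule para_hurwitz_onE) blast
  obtain v where u: "u = of_model v" using of_to_model by metis
  have "v \<noteq> 0" "v \<odot> v = v"
    using *(4,5) unfolding u by (auto simp: of_model_simps of_model_eq_iff simp flip: of_model_mult)
  then have v: "v $ One = -1" "v $ U = 0" "v $ V = 0" using model_idempotent_iff by blast+
  show thesis
  proof (rule that[OF *(1-3) *(6-8)])
    fix x assume x: "x \<in> S" "polar N x u = 0"
    obtain y where y: "x = of_model y" using of_to_model by metis
    have "v \<odot> y = - y" "y \<odot> v = - y"
      using im(1,2)[OF x] unfolding u y
      by (simp_all add: of_model_eq_iff flip: of_model_mult of_model_simps)
    then have "y $ One = 0" using model_imaginary v by blast
    moreover have "a \<odot> y = y \<odot> a" using x(1) S y of_model_in_centralizer by blast
    moreover have "N x = 0" if "y \<odot> y = 0"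
      using im(3)[OF x] that *(4) unfolding y
      by (simp add: of_model_simps vec.scale_eq_0_iff flip: of_model_mult)
    ultimately show "a \<odot> to_model x = to_model x \<odot> a \<and> to_model x $ One = 0
        \<and> (to_model x \<odot> to_model x = 0 \<longrightarrow> N x = 0)"
      by (simp add: y)
  qed
qed

text \<open>Every imaginary element has square zero, hence norm 0, which bounds the dimension by 1.
  This excludes para-quadratic and para-quaternion algebras together.\<close>

lemma no_para_hurwitz_first:
  fixes a :: "'a model"
  assumes a: "a $ U = 0" "a $ V = 0" "a $ UU = 0" "a $ UV = 0" "a $ VV = 0" "a $ UUV \<noteq> 0 \<or> a $ UVV \<noteq> 0"
    and d: "2 \<le> d"
  shows "\<not> (\<exists>S \<subseteq> centralizer (of_model a). para_hurwitz_on d S (\<star>))"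
proof
  assume "\<exists>S \<subseteq> centralizer (of_model a). para_hurwitz_on d S (\<star>)"
  then obtain S where S: "para_hurwitz_on d S (\<star>)" "S \<subseteq> centralizer (of_model a)" by blast
  have "0 < d" using d by simp
  from S(1) this S(2) obtain u N where *: "vec.subspace S" "vec.dim S = d" "u \<in> S"
    "quadratic_form_on S N" "nondegenerate_on S N" "N u = 1"
    and im: "\<And>x. x \<in> S \<Longrightarrow> polar N x u = 0 \<Longrightarrow> a \<odot> to_model x = to_model x \<odot> a \<and> to_model x $ One = 0
      \<and> (to_model x \<odot> to_model x = 0 \<longrightarrow> N x = 0)"
    by (rule para_hurwitz_in_centralizer) blast
  have "vec.dim S \<le> 1"
    by (rule dim_le_1_if_isotropic_imaginary[OF *(1,3-6) two_neq_0])
      (use im model_square_zero_if_commute_first a in blast)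
  then show False using *(2) d by simp
qed

text \<open>Imaginary elements in the hyperplane cut out by one linear coordinate are isotropic, so
  the dimension is at most 3.\<close>

lemma no_para_quaternion_second:
  fixes a :: "'a model"
  assumes a: "a $ U = 0" "a $ V = 0" "(a $ UV)\<^sup>2 = a $ UU * a $ VV" "a $ UU \<noteq> 0 \<or> a $ VV \<noteq> 0"
  shows "\<not> contains_para_quaternion (centralizer (of_model a))"
proof
  assume "contains_para_quaternion (centralizer (of_model a))"
  then obtain S where S: "para_quaternion_on S (\<star>)" "S \<subseteq> centralizer (of_model a)"
    unfolding contains_para_quaternion_def by blast
  have "0 < (4::nat)" by simp
  from S(1) this S(2) obtain u N where *: "vec.subspace S" "vec.dim S = 4" "u \<in> S"
    "quadratic_form_on S N" "nondegenerate_on S N" "N u = 1"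
    and im: "\<And>x. x \<in> S \<Longrightarrow> polar N x u = 0 \<Longrightarrow> a \<odot> to_model x = to_model x \<odot> a \<and> to_model x $ One = 0
      \<and> (to_model x \<odot> to_model x = 0 \<longrightarrow> N x = 0)"
    by (rule para_hurwitz_in_centralizer) blast
  have "vec.dim S \<le> 3"
  proof (rule dim_le_3_if_isotropic_imaginary_hyperplane[OF *(1,3-6) two_neq_0])
    show "N x = 0" if "x \<in> S" "polar N x u = 0" "to_model x $ (if a $ UU = 0 then V else U) = 0" for x
      using im[OF that(1,2)] model_square_zero_if_commute_second(3)[OF _ a] that(3) by blast
  qed (simp_all add: to_model_simps)
  then show False using *(2) by simp
qed

text \<open>An element on which \<open>a\<close> acts as -1 from both sides, and whose square is a
  nonzero multiple of \<open>a\<close>, spans with \<open>a\<close> a para-quadratic algebra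
  commuting with \<open>a\<close>.\<close>

lemma contains_para_quadratic_second:
  fixes a :: "'a model"
  assumes a: "a $ One = -1" "a $ U = 0" "a $ V = 0" "(a $ UV)\<^sup>2 = a $ UU * a $ VV" "a $ UU \<noteq> 0 \<or> a $ VV \<noteq> 0"
  shows "contains_para_quadratic (centralizer (of_model a))"
proof -
  have idem: "a \<noteq> 0" "a \<odot> a = a" using model_idempotent_iff a by blast+
  have "algebra_product_on UNIV ((\<odot>) :: 'a model \<Rightarrow> _)" by (rule algebra_product_model)
  note product = this[unfolded algebra_product_on_def, simplified]
  have span: "contains_para_quadratic (centralizer (of_model a))"
    if y: "a \<odot> y = - y" "y \<odot> a = - y" "y \<odot> y = d *s a" "d \<noteq> 0" for y d
  proof -
    have "para_quadratic_on (vec.span {of_model a, of_model y}) (\<star>)"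
      by (rule para_quadratic_on_span[OF algebra_product_okubo two_neq_0, of _ _ d])
        (use idem y in \<open>simp_all add: of_model_eq_iff flip: of_model_mult of_model_simps\<close>)
    moreover have "vec.span {of_model a, of_model y} \<subseteq> centralizer (of_model a)"
    proof
      fix x assume "x \<in> vec.span {of_model a, of_model y}"
      then obtain s t where "x = of_model (s *s a + t *s y)" by (auto simp: mem_span_pair of_model_simps)
      moreover have "a \<odot> (s *s a + t *s y) = (s *s a + t *s y) \<odot> a"
        using y(1,2) by (simp add: product)
      ultimately show "x \<in> centralizer (of_model a)" using of_model_in_centralizer by blast
    qed
    ultimately show ?thesis unfolding contains_para_quadratic_def by blast
  qed
  \<comment> \<open>The quadratic relation in both shapes that occur in right-nested normalized
    products.\<close>
  have UV: "a $ UV * a $ UV = a $ UU * a $ VV" "a $ UV * (a $ UV * z) = a $ UU * (a $ VV * z)" for z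
    using a(4) by (simp_all add: power2_eq_square flip: mult.assoc)
  txt \<open>\<open>y\<close> and \<open>z\<close> are square roots of \<open>(a + 1)\<close> times the cube of \<open>a $ UU\<close>, resp. \<open>a $ VV\<close>, in \<open>A\<close>.\<close>
  define y where "y = (a $ UU)\<^sup>2 *s axis U 1 - (a $ UU * a $ UV) *s axis V 1 - (a $ UU * a $ UUV) *s axis UV 1
    - (a $ UU * a $ UVV + a $ UV * a $ UUV) *s axis VV 1 - (a $ UU - (a $ UUV)\<^sup>2) *s axis UVV 1"
  define z where "z = (a $ VV)\<^sup>2 *s axis V 1 - (a $ VV * a $ UV) *s axis U 1 - (a $ VV * a $ UVV) *s axis UV 1
    - (a $ VV * a $ UUV + a $ UV * a $ UVV) *s axis UU 1 - (a $ VV - (a $ UVV)\<^sup>2) *s axis UUV 1"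
  show ?thesis
  proof (cases "a $ UU = 0")
    case False
    show ?thesis
    proof (rule span)
      show "a \<odot> y = - y" "y \<odot> a = - y" "y \<odot> y = (a $ UU) ^ 3 *s a"
        using a(1-3) unfolding y_def
        by (simp_all add: vec_eq_iff all_tmon model_mult_nth axis_def mod_3 UV power2_eq_square power3_eq_cube algebra_simps)
    qed (use False in simp)
  next
    case True
    then have "a $ UV = 0" "a $ VV \<noteq> 0" using a by auto
    show ?thesis
    proof (rule span)
      show "a \<odot> z = - z" "z \<odot> a = - z" "z \<odot> z = (a $ VV) ^ 3 *s a"
        using a(1-3) True \<open>a $ UV = 0\<close> unfolding z_def
        by (simp_all add: vec_eq_iff all_tmon model_mult_nth axis_def mod_3 power2_eq_square power3_eq_cube algebra_simps)
    qed (use \<open>a $ VV \<noteq> 0\<close> in simp)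
  qed
qed

end
section \<open>The two types\<close>

context char_3
begin

lemma square_zero_orthogonal_second:
  fixes a :: "'a model"
  assumes a: "a $ One = 0" "a $ U = 0" "a $ V = 0" "(a $ UV)\<^sup>2 = a $ UU * a $ VV" "a $ UU \<noteq> 0 \<or> a $ VV \<noteq> 0"
  obtains W where "vec.subspace W" "vec.dim W = 2" "{y \<in> orthogonalizer (of_model a). y \<star> y = 0} \<subseteq> W"
proof -
  \<comment> \<open>If the quadratic part of \<open>b\<close> is \<open>s\<close> times that of
    \<open>a\<close>, commutation makes the cubic part of \<open>b - s *s a\<close> proportional to
    \<open>(a $ UU, a $ UV)\<close>, or to \<open>(0, 1)\<close> when \<open>a $ UU = 0\<close>.
    This gives the second generator.\<close>
  define w where "w = (if a $ UU = 0 then axis UVV 1 else axis UUV (a $ UU) + axis UVV (a $ UV))"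
  let ?W = "vec.span {of_model a, of_model w}"
  have zero: "a $ UV = 0" "a $ VV \<noteq> 0" if "a $ UU = 0" using a(4,5) that by auto
  have "s = 0 \<and> t = 0" if "s *s of_model a + t *s of_model w = 0" for s t
  proof -
    have "of_model (s *s a + t *s w) = of_model 0" using that by (simp add: of_model_simps)
    then have "s *s a + t *s w = 0" by (simp only: of_model_eq_iff)
    then have eq: "s * a $ k + t * w $ k = 0" for k by (simp add: vec_eq_iff)
    have "s = 0" using eq[of UU] eq[of VV] zero by (cases "a $ UU = 0") (auto simp: w_def axis_def)
    then show ?thesis
      using eq[of UUV] eq[of UVV] by (cases "a $ UU = 0") (auto simp: w_def axis_def)
  qed
  then have "vec.dim ?W = 2" by (rule dim_span_pair)
  moreover have "{y \<in> orthogonalizer (of_model a). y \<star> y = 0} \<subseteq> ?W"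
  proof clarify
    fix y assume y: "y \<in> orthogonalizer (of_model a)" "y \<star> y = 0"
    obtain b where b: "y = of_model b" using of_to_model by metis
    have "a \<odot> b = b \<odot> a" "b \<odot> b = 0"
      using y unfolding b orthogonalizer_def by (auto simp: of_model_eq_iff simp flip: of_model_mult of_model_simps(3))
    note comm = model_commute[OF this(1) a(2,3)] and sq = this(2)[unfolded model_square_zero_iff]
    have "\<exists>s t. b = s *s a + t *s w"
    proof (cases "a $ UU = 0")
      case True
      define s where "s = b $ VV / a $ VV"
      have VV: "b $ VV = s * a $ VV" using zero(2)[OF True] by (simp add: s_def)
      have "b $ UU = 0" "b $ UV = 0" "b $ UUV = s * a $ UUV"
        using comm(4,5,7) zero[OF True] True sq VV by (auto simp: mult.left_commute)
      then have "b = s *s a + (b $ UVV - s * a $ UVV) *s w"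
        using a(1-3) sq True zero[OF True] VV by (simp add: vec_eq_iff all_tmon w_def axis_def)
      then show ?thesis by blast
    next
      case False
      define s where "s = b $ UU / a $ UU"
      define t where "t = (b $ UUV - s * a $ UUV) / a $ UU"
      have UU: "b $ UU = s * a $ UU" and UUV: "b $ UUV = s * a $ UUV + t * a $ UU"
        using False by (simp_all add: s_def t_def)
      have "a $ UU * b $ UV = a $ UU * (s * a $ UV)" "a $ UU * b $ VV = a $ UU * (s * a $ VV)"
        using comm(3,4) sq UU by algebra+
      then have UV: "b $ UV = s * a $ UV" and VV: "b $ VV = s * a $ VV" using False by auto
      have "a $ UU * b $ UVV = a $ UU * (s * a $ UVV + t * a $ UV)"
        using comm(6) sq UU UV UUV by algebra
      then have "b $ UVV = s * a $ UVV + t * a $ UV" using False by simp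
      then have "b = s *s a + t *s w"
        using a(1-3) sq False UU UV VV UUV by (simp add: vec_eq_iff all_tmon w_def axis_def)
      then show ?thesis by blast
    qed
    then show "y \<in> ?W" unfolding b mem_span_pair by (metis of_model_simps(1,2))
  qed
  ultimately show thesis by (intro that[of ?W]) auto
qed

lemma okubo_idempotent_of_model:
  fixes a :: "'a model"
  shows "okubo_idempotent (of_model a) \<longleftrightarrow>
    a $ One = -1 \<and> a $ U = 0 \<and> a $ V = 0 \<and> (a $ UV)\<^sup>2 = a $ UU * a $ VV"
  using model_idempotent_iff[of a]
  by (auto simp: okubo_idempotent_def of_model_eq_iff simp flip: of_model_mult of_model_simps(3))

text \<open>The two exclusions rule out a nonzero quadratic part and then a nonzero cubic
  part.\<close>

lemma quaternionic_idempotent_unique: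
  fixes e :: "'a okubo"
  assumes "quaternionic_idempotent e"
  shows "e = of_model (- axis One 1)"
proof -
  obtain a where e: "e = of_model a" using of_to_model by metis
  have a: "a $ One = -1" "a $ U = 0" "a $ V = 0" "(a $ UV)\<^sup>2 = a $ UU * a $ VV"
    and quat: "contains_para_quaternion (centralizer (of_model a))"
    using assms okubo_idempotent_of_model unfolding e quaternionic_idempotent_def by blast+
  have "a $ UU = 0" "a $ VV = 0" using no_para_quaternion_second a quat by blast+
  moreover from this have "a $ UV = 0" using a(4) by simp
  moreover have "a $ UUV = 0" "a $ UVV = 0"
    using no_para_hurwitz_first[of a 4] a quat calculation unfolding contains_para_quaternion_def by auto
  ultimately have "a = - axis One 1" using a by (simp add: vec_eq_iff all_tmon axis_def)
  then show ?thesis by (simp add: e)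
qed

text \<open>Here \<open>a\<close> is purely cubic. The norm pairs cubic with linear coordinates, and
  elements commuting with \<open>- axis One 1\<close> have no linear part.\<close>

lemma first_type_of_model:
  fixes a :: "'a model"
  assumes a: "a \<noteq> 0" "a \<odot> a = 0" "a $ UU = 0" "a $ VV = 0"
  shows "first_type (of_model (- axis One 1)) (of_model a)"
proof -
  define f where "f = - axis One 1 + a"
  have a': "a $ One = 0" "a $ U = 0" "a $ V = 0" "a $ UV = 0"
    using a(2-4) by (auto simp: model_square_zero_iff)
  then have ne: "a $ UUV \<noteq> 0 \<or> a $ UVV \<noteq> 0" using a by (auto simp: vec_eq_iff all_tmon)
  have "singular_idempotent (of_model f)"
  proof -
    have "f $ U = 0" "f $ V = 0" "f $ UU = 0" "f $ UV = 0" "f $ VV = 0" "f $ UUV \<noteq> 0 \<or> f $ UVV \<noteq> 0"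
      "f $ One = -1"
      using a a' ne by (simp_all add: f_def axis_def)
    then show ?thesis
      using no_para_hurwitz_first[of f 4] no_para_hurwitz_first[of f 2]
      by (simp add: singular_idempotent_def quaternionic_idempotent_def quadratic_idempotent_def
          okubo_idempotent_of_model contains_para_quaternion_def contains_para_quadratic_def)
  qed
  moreover have "of_model a \<bottom>\<bottom> centralizer (of_model (- axis One 1))"
    unfolding perp_def
  proof
    fix y assume y: "y \<in> centralizer (of_model (- axis One (1::'a)))"
    obtain b where b: "y = of_model b" using of_to_model by metis
    have "- axis One 1 \<odot> b = b \<odot> - axis One 1" using y unfolding b of_model_in_centralizer .
    from model_commute(6,7)[OF this] have "b $ U = 0" "b $ V = 0" by (simp_all add: axis_def)
    then show "polar okubo_norm (of_model a) y = 0" using a a' by (simp add: b polar_of_model)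
  qed
  moreover have "y \<star> y = 0" if y: "y \<in> orthogonalizer (of_model a)" for y
  proof -
    obtain b where b: "y = of_model b" using of_to_model by metis
    have ab: "a \<odot> b = 0" "b \<odot> a = 0"
      using y unfolding b orthogonalizer_def by (auto simp: of_model_eq_iff simp flip: of_model_mult of_model_simps(3))
    \<comment> \<open>The bracket cancels in this sum, whose cubic coordinates are
      \<open>2 * b $ One\<close> times those of \<open>a\<close>.\<close>
    have "(a \<odot> b + b \<odot> a) $ k = 0" for k using ab by simp
    from this[of UUV] this[of UVV] have "b $ One = 0"
      using a a' ne by (auto simp: model_mult_nth mod_3 algebra_simps)
    then have "b \<odot> b = 0"
      using model_square_zero_if_commute_first[of a b] ab a a' ne by simp
    then show ?thesis by (simp add: b of_model_simps flip: of_model_mult)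
  qed
  moreover have "of_model f = of_model (- axis One 1) + of_model a"
    unfolding f_def by (rule of_model_simps)
  ultimately show ?thesis by (simp add: first_type_def)
qed

text \<open>The monomials \<open>UU\<close> and \<open>VV\<close> commute with
  \<open>- axis One 1\<close> and pair with the \<open>VV\<close> and \<open>UU\<close> coordinates
  of \<open>a\<close>. The second conclusion separates the two types.\<close>

lemma second_type_of_model:
  fixes a :: "'a model"
  assumes a: "a \<odot> a = 0" "a $ UU \<noteq> 0 \<or> a $ VV \<noteq> 0"
  shows "second_type (of_model (- axis One 1)) (of_model a)"
    and "\<not> of_model a \<bottom>\<bottom> centralizer (of_model (- axis One 1))"
proof -
  define f where "f = - axis One 1 + a"
  have a': "a $ One = 0" "a $ U = 0" "a $ V = 0" "(a $ UV)\<^sup>2 = a $ UU * a $ VV"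
    using a(1) by (auto simp: model_square_zero_iff)
  have "quadratic_idempotent (of_model f)"
  proof -
    have f: "f $ One = -1" "f $ U = 0" "f $ V = 0" "(f $ UV)\<^sup>2 = f $ UU * f $ VV" "f $ UU \<noteq> 0 \<or> f $ VV \<noteq> 0"
      using a a' by (simp_all add: f_def axis_def)
    then show ?thesis
      using no_para_quaternion_second[OF f(2-5)] contains_para_quadratic_second[OF f]
      by (simp add: quadratic_idempotent_def okubo_idempotent_of_model)
  qed
  moreover show not_perp: "\<not> of_model a \<bottom>\<bottom> centralizer (of_model (- axis One 1))"
  proof
    assume perp: "of_model a \<bottom>\<bottom> centralizer (of_model (- axis One 1))"
    have "of_model (axis k 1) \<in> centralizer (of_model (- axis One (1::'a)))" if "k = UU \<or> k = VV" for k
      unfolding of_model_in_centralizer using that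
      by (auto simp: vec_eq_iff all_tmon model_mult_nth axis_def)
    then have "polar okubo_norm (of_model a) (of_model (axis UU 1)) = 0"
      "polar okubo_norm (of_model a) (of_model (axis VV 1)) = 0"
      using perp unfolding perp_def by blast+
    then show False using a(2) by (simp add: polar_of_model axis_def)
  qed
  moreover obtain W where "vec.subspace W" "vec.dim W = 2" "{y \<in> orthogonalizer (of_model a). y \<star> y = 0} \<subseteq> W"
    using square_zero_orthogonal_second[OF a' a(2)] .
  moreover have "of_model f = of_model (- axis One 1) + of_model a"
    unfolding f_def by (rule of_model_simps)
  ultimately show "second_type (of_model (- axis One 1)) (of_model a)"
    unfolding second_type_def by auto
qed

end

theorem corollary4p15:
  fixes e :: "'a::field okubo"
  assumes "CHAR('a) = 3"
    and "quaternionic_idempotent e"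
  shows "(\<forall>x \<in> zero_divisors. x \<star> x = 0 \<longrightarrow> first_type e x \<or> second_type e x)
    \<and> (\<forall>x \<in> zero_divisors. \<forall>x' \<in> zero_divisors.
         x \<star> x = 0 \<and> x' \<star> x' = 0 \<and> first_type e x \<and> first_type e x' \<longrightarrow> same_orbit x x')
    \<and> ((\<forall>p :: 'a poly. degree p > 0 \<longrightarrow> (\<exists>r. poly p r = 0)) \<longrightarrow>
       (\<forall>x \<in> zero_divisors. \<forall>x' \<in> zero_divisors.
         x \<star> x = 0 \<and> x' \<star> x' = 0 \<and> second_type e x \<and> second_type e x' \<longrightarrow> same_orbit x x'))"
proof -
  have "(3::'a) = of_nat CHAR('a)" using assms(1) by simp
  then have "(3::'a) = 0" by (simp only: of_nat_CHAR)
  then interpret char_3 "TYPE('a)" by unfold_locales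
  have e: "e = of_model (- axis One 1)" using assms(2) by (rule quaternionic_idempotent_unique)
  have model: "\<exists>a. x = of_model a \<and> a \<noteq> 0 \<and> a \<odot> a = 0" if "x \<in> zero_divisors" "x \<star> x = 0" for x :: "'a okubo"
  proof -
    obtain a where a: "x = of_model a" using of_to_model by metis
    then show ?thesis
      using that unfolding zero_divisors_def
      by (auto simp: of_model_eq_iff simp flip: of_model_mult of_model_simps(3))
  qed
  have types: "first_type e x \<or> second_type e x" if "x \<in> zero_divisors" "x \<star> x = 0" for x
  proof -
    from model[OF that] obtain a where "x = of_model a" "a \<noteq> 0" "a \<odot> a = 0" by blast
    then show ?thesis using first_type_of_model second_type_of_model(1) unfolding e by blast
  qed
  have first: "same_orbit x (of_model (axis UUV 1))"
    if "x \<in> zero_divisors" "x \<star> x = 0" "first_type e x" for x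
  proof -
    from model[OF that(1,2)] obtain a where a: "x = of_model a" "a \<noteq> 0" "a \<odot> a = 0" by blast
    \<comment> \<open>A nonzero quadratic part would contradict orthogonality to the centralizer of
      \<open>e\<close>.\<close>
    then have UU: "a $ UU = 0" "a $ VV = 0"
      using second_type_of_model(2) that(3) unfolding e first_type_def by blast+
    then show ?thesis
      using a model_square_zero_iff[of a] by (auto intro: normal_form_first)
  qed
  have second: "same_orbit x (of_model (axis UU 1))"
    if "\<forall>p :: 'a poly. degree p > 0 \<longrightarrow> (\<exists>r. poly p r = 0)"
      "x \<in> zero_divisors" "x \<star> x = 0" "second_type e x" for x
  proof -
    from model[OF that(2,3)] obtain a where a: "x = of_model a" "a \<noteq> 0" "a \<odot> a = 0" by blast
    then have "a $ UU \<noteq> 0 \<or> a $ VV \<noteq> 0"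
      using first_type_of_model that(4) unfolding e first_type_def second_type_def by blast
    then show ?thesis
      using a that(1) model_square_zero_iff[of a] by (auto intro: normal_form_second)
  qed
  have orbit: "same_orbit x x'" if "same_orbit x z" "same_orbit x' z" for x x' z :: "'a okubo"
    using that same_orbit_sym same_orbit_trans by blast
  show ?thesis
  proof (intro conjI ballI impI; (elim conjE)?)
    show "first_type e x \<or> second_type e x" if "x \<in> zero_divisors" "x \<star> x = 0" for x
      using types that .
    show "same_orbit x x'" if "x \<in> zero_divisors" "x' \<in> zero_divisors" "x \<star> x = 0" "x' \<star> x' = 0"
      "first_type e x" "first_type e x'" for x x'
      using that by (intro orbit[OF first first])
    show "same_orbit x x'" if "\<forall>p :: 'a poly. degree p > 0 \<longrightarrow> (\<exists>r. poly p r = 0)"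
      "x \<in> zero_divisors" "x' \<in> zero_divisors" "x \<star> x = 0" "x' \<star> x' = 0"
      "second_type e x" "second_type e x'" for x x'
      using that by (intro orbit[OF second second])
  qed
qed

end
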